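(* Let $f\colon\mathbb{N}\to\mathbb{N}$ be a right-c.e. function such that for every sequence $A\in 2^\omega$: there is a constant $c$ with $\mathrm{C}(A\upharpoonright n)\ge n-f(n)-c$ for all $n$ if and only if $A$ is Martin-Löf random. Then $f$ is a weak Solovay function. In particular, if $f$ is computable then $f$ is a Solovay function.
   Context: $\mathrm{K}$ denotes prefix-free and $\mathrm{C}$ plain Kolmogorov complexity; $A\upharpoonright n$ is the length-$n$ prefix of $A$. A function $f$ is right-c.e. if there is a computable $(x,t)\mapsto f_t(x)$, nonincreasing in $t$, converging to $f(x)$ for every $x$. A Solovay function is a computable $g$ with $\mathrm{K}(n)\le g(n)+O(1)$ for all $n$ and $g(n)\le \mathrm{K}(n)+O(1)$ for infinitely many $n$; a weak Solovay function is a right-c.e. function with these two properties. *)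

theory Defs
  imports "HOL-Probability.Probability" "HOL-Library.Nat_Bijection" "HOL-Library.Sublist"
begin

section \<open>Partial recursive functions\<close>

definition minimize :: "(nat \<rightharpoonup> nat) \<Rightarrow> nat option" where
  "minimize h =
    (if \<exists>n. h n = Some 0 \<and> (\<forall>m<n. h m \<noteq> None) then Some (LEAST n. h n = Some 0) else None)"

primrec iterate :: "(nat \<rightharpoonup> nat) \<Rightarrow> (nat \<rightharpoonup> nat) \<Rightarrow> nat \<Rightarrow> nat \<Rightarrow> nat option" where
  "iterate f g a 0 = f a"
| "iterate f g a (Suc k) =
    Option.bind (iterate f g a k) (\<lambda>r. g (prod_encode (a, prod_encode (k, r))))"

text \<open>
  The class of partial recursive functions, presented with unary functions only: several arguments
  are passed as one number by means of the pairing function \<open>prod_encode\<close>. The clauses are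
  Kleene's: basic functions, composition, primitive recursion (\<open>iterate\<close>) and
  unbounded search (\<open>minimize\<close>).
\<close>

inductive partrec :: "(nat \<rightharpoonup> nat) \<Rightarrow> bool" where
  zero: "partrec (\<lambda>_. Some 0)"
| succ: "partrec (\<lambda>n. Some (Suc n))"
| left: "partrec (\<lambda>n. Some (fst (prod_decode n)))"
| right: "partrec (\<lambda>n. Some (snd (prod_decode n)))"
| pair: "partrec f \<Longrightarrow> partrec g \<Longrightarrow>
    partrec (\<lambda>n. Option.bind (f n) (\<lambda>a. Option.bind (g n) (\<lambda>b. Some (prod_encode (a, b)))))"
| comp: "partrec f \<Longrightarrow> partrec g \<Longrightarrow> partrec (\<lambda>n. Option.bind (g n) f)"
| prec: "partrec f \<Longrightarrow> partrec g \<Longrightarrow>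
    partrec (\<lambda>n. iterate f g (fst (prod_decode n)) (snd (prod_decode n)))"
| search: "partrec f \<Longrightarrow> partrec (\<lambda>a. minimize (\<lambda>n. f (prod_encode (a, n))))"

definition computable :: "(nat \<Rightarrow> nat) \<Rightarrow> bool" where
  "computable f \<longleftrightarrow> partrec (\<lambda>n. Some (f n))"

definition computable2 :: "(nat \<Rightarrow> nat \<Rightarrow> nat) \<Rightarrow> bool" where
  "computable2 h \<longleftrightarrow> partrec (\<lambda>n. Some (h (fst (prod_decode n)) (snd (prod_decode n))))"

definition ce :: "nat set \<Rightarrow> bool" where
  "ce S \<longleftrightarrow> (\<exists>g. partrec g \<and> S = dom g)"

definition right_ce :: "(nat \<Rightarrow> nat) \<Rightarrow> bool" where
  "right_ce f \<longleftrightarrow> (\<exists>h. computable2 h \<and>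
    (\<forall>x. antimono (h x)) \<and> (\<forall>x. (\<lambda>t. h x t) \<longlonglongrightarrow> f x))"

section \<open>Binary strings\<close>

text \<open>Bijective base-2 numeration, least significant digit first.\<close>

fun nat_of_str :: "bool list \<Rightarrow> nat" where
  "nat_of_str [] = 0"
| "nat_of_str (b # s) = 2 * nat_of_str s + (if b then 2 else 1)"

lemma bij_nat_of_str: "bij nat_of_str"
proof (rule bijI)
  have "s = t" if "nat_of_str s = nat_of_str t" for s t
    using that
  proof (induction s arbitrary: t)
    case Nil
    then show ?case by (cases t) (auto split: if_splits)
  next
    case (Cons b s)
    then obtain c u where t: "t = c # u" by (cases t) (auto split: if_splits)
    have "b = c \<and> nat_of_str s = nat_of_str u"
      using Cons.prems unfolding t by (cases b; cases c; simp; presburger)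
    then show ?case using Cons.IH t by blast
  qed
  then show "inj nat_of_str" by (rule injI)
next
  have "\<exists>s. nat_of_str s = n" for n
  proof (induction n rule: less_induct)
    case (less n)
    show ?case
    proof (cases "n = 0")
      case True
      then show ?thesis by (intro exI[of _ "[]"]) simp
    next
      case False
      then have "(n - 1) div 2 < n" by linarith
      then obtain s where s: "nat_of_str s = (n - 1) div 2"
        using less.IH by blast
      have "nat_of_str (even n # s) = n"
      proof (cases "even n")
        case True
        with False obtain k where "n = 2 * Suc k"
          by (metis evenE mult_0_right not0_implies_Suc)
        then show ?thesis using s by simp
      next
        case odd: False
        then obtain k where "n = 2 * k + 1" by (rule oddE)
        then show ?thesis using s by simp
      qed
      then show ?thesis by blast
    qed
  qed
  then show "surj nat_of_str" unfolding surj_def by metis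
qed

definition str_of_nat :: "nat \<Rightarrow> bool list" where
  "str_of_nat = inv nat_of_str"

definition initial :: "(nat \<Rightarrow> bool) \<Rightarrow> nat \<Rightarrow> bool list" where
  "initial A n = map A [0..<n]"

section \<open>Machines and Kolmogorov complexity\<close>

type_synonym machine = "bool list \<rightharpoonup> bool list"

definition computable_machine :: "machine \<Rightarrow> bool" where
  "computable_machine M \<longleftrightarrow>
    partrec (\<lambda>n. map_option nat_of_str (M (str_of_nat n)))"

definition prefix_free :: "machine \<Rightarrow> bool" where
  "prefix_free M \<longleftrightarrow> (\<forall>p\<in>dom M. \<forall>q\<in>dom M. prefix p q \<longrightarrow> p = q)"

definition simulates :: "machine \<Rightarrow> machine \<Rightarrow> bool" where
  "simulates U M \<longleftrightarrow>
    (\<exists>c. \<forall>p x. M p = Some x \<longrightarrow> (\<exists>q. U q = Some x \<and> length q \<le> length p + c))"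

definition optimal_plain :: "machine \<Rightarrow> bool" where
  "optimal_plain U \<longleftrightarrow> computable_machine U \<and>
    (\<forall>M. computable_machine M \<longrightarrow> simulates U M)"

definition optimal_prefix_free :: "machine \<Rightarrow> bool" where
  "optimal_prefix_free U \<longleftrightarrow> computable_machine U \<and> prefix_free U \<and>
    (\<forall>M. computable_machine M \<and> prefix_free M \<longrightarrow> simulates U M)"

text \<open>
  Length of a shortest description. This is plain complexity C if the machine is an optimal plain
  machine, and prefix-free complexity K if it is an optimal prefix-free machine. In both cases
  every string has a description (\<open>optimal_plain_total\<close>, \<open>optimal_prefix_free_total\<close>
  below), so the minimum is over a nonempty set.
\<close>

definition complexity :: "machine \<Rightarrow> bool list \<Rightarrow> nat" where
  "complexity U x = (LEAST k. \<exists>p. length p = k \<and> U p = Some x)"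

definition complexity_nat :: "machine \<Rightarrow> nat \<Rightarrow> nat" where
  "complexity_nat U n = complexity U (str_of_nat n)"

lemma partrec_const: "partrec (\<lambda>_. Some c)"
proof (induction c)
  case 0
  show ?case by (rule partrec.zero)
next
  case (Suc c)
  from partrec.comp[OF partrec.succ this] show ?case by simp
qed

lemma computable_machine_single: "computable_machine [[] \<mapsto> x]"
proof -
  have "partrec (\<lambda>a. minimize (\<lambda>n. Some (fst (prod_decode (prod_encode (a, n))))))"
    by (rule partrec.search[OF partrec.left])
  also have "(\<lambda>a. minimize (\<lambda>n. Some (fst (prod_decode (prod_encode (a, n))))))
      = (\<lambda>a. if a = 0 then Some 0 else None)"
    by (auto simp: minimize_def)
  finally have "partrec (\<lambda>a. if a = 0 then Some 0 else None)" .
  from partrec.comp[OF partrec_const[of "nat_of_str x"] this]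
  have "partrec (\<lambda>a. Option.bind (if a = 0 then Some (0::nat) else None) (\<lambda>_. Some (nat_of_str x)))" .
  also have "(\<lambda>a. Option.bind (if a = 0 then Some (0::nat) else None) (\<lambda>_. Some (nat_of_str x)))
      = (\<lambda>n. map_option nat_of_str ([[] \<mapsto> x] (str_of_nat n)))"
  proof
    fix n
    have "str_of_nat n = [] \<longleftrightarrow> n = 0"
      unfolding str_of_nat_def
      using bij_inv_eq_iff[OF bij_nat_of_str, of "[]" n] by auto
    then show "Option.bind (if n = 0 then Some (0::nat) else None) (\<lambda>_. Some (nat_of_str x))
        = map_option nat_of_str ([[] \<mapsto> x] (str_of_nat n))"
      by auto
  qed
  finally show ?thesis by (simp add: computable_machine_def)
qed

lemma simulates_single: "simulates U [[] \<mapsto> x] \<Longrightarrow> \<exists>p. U p = Some x"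
proof -
  assume "simulates U [[] \<mapsto> x]"
  then obtain c where "\<forall>(p::bool list) y. [[] \<mapsto> x] p = Some y \<longrightarrow> (\<exists>q. U q = Some y \<and> length q \<le> length p + c)"
    unfolding simulates_def by blast
  from this[rule_format, of "[]" x] show ?thesis by auto
qed

lemma optimal_plain_total: "optimal_plain U \<Longrightarrow> \<exists>p. U p = Some x"
  using computable_machine_single[of x] simulates_single
  unfolding optimal_plain_def by blast

lemma optimal_prefix_free_total: "optimal_prefix_free U \<Longrightarrow> \<exists>p. U p = Some x"
proof -
  assume U: "optimal_prefix_free U"
  have "prefix_free [[] \<mapsto> x]" by (simp add: prefix_free_def)
  with U computable_machine_single[of x] have "simulates U [[] \<mapsto> x]"
    unfolding optimal_prefix_free_def by blast
  then show ?thesis by (rule simulates_single)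
qed

section \<open>Martin-Loef randomness\<close>

definition cantor_measure :: "(nat \<Rightarrow> bool) measure" where
  "cantor_measure = PiM UNIV (\<lambda>_. measure_pmf (bernoulli_pmf (1/2)))"

definition cylinders :: "bool list set \<Rightarrow> (nat \<Rightarrow> bool) set" where
  "cylinders W = {A. \<exists>n. initial A n \<in> W}"

definition ml_test :: "(nat \<Rightarrow> bool list set) \<Rightarrow> bool" where
  "ml_test W \<longleftrightarrow>
    ce {prod_encode (n, nat_of_str s) | n s. s \<in> W n} \<and>
    (\<forall>n. measure cantor_measure (cylinders (W n)) \<le> (1/2) ^ n)"

definition ml_random :: "(nat \<Rightarrow> bool) \<Rightarrow> bool" where
  "ml_random A \<longleftrightarrow> (\<forall>W. ml_test W \<longrightarrow> A \<notin> (\<Inter>n. cylinders (W n)))"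

section \<open>Solovay functions\<close>

text \<open>The parameter \<open>V\<close> is the optimal prefix-free machine defining K.\<close>

definition solovay_bounds :: "machine \<Rightarrow> (nat \<Rightarrow> nat) \<Rightarrow> bool" where
  "solovay_bounds V g \<longleftrightarrow>
    (\<exists>c. \<forall>n. complexity_nat V n \<le> g n + c) \<and>
    (\<exists>c. infinite {n. g n \<le> complexity_nat V n + c})"

definition solovay_function :: "machine \<Rightarrow> (nat \<Rightarrow> nat) \<Rightarrow> bool" where
  "solovay_function V g \<longleftrightarrow> computable g \<and> solovay_bounds V g"

definition weak_solovay_function :: "machine \<Rightarrow> (nat \<Rightarrow> nat) \<Rightarrow> bool" where
  "weak_solovay_function V g \<longleftrightarrow> right_ce g \<and> solovay_bounds V g"

end

theory Submission
  imports Defs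
begin

text \<open>
  If the sum of \<open>2^-f(n)\<close> diverges, intervals of these lengths cover the circle infinitely often, so
  that no sequence satisfies the complexity bound. Hence the sum converges, and the Kraft-Chaitin
  construction gives \<open>K \<le> f + O(1)\<close>.

  If \<open>f - K\<close> tends to infinity, then the part of the sum that is still missing at a late stage is an
  arbitrarily small fraction of the measure of descriptions that is still missing. This yields an
  enumerable set of pairs \<open>(t, j)\<close> with a small sum of \<open>2^-j\<close>, some of which satisfy
  \<open>\<Sum>n\<ge>t. 2^-f(n) < \<epsilon> * 2^-j\<close>. A block of \<open>j\<close> zeros at such a position \<open>t\<close> is caught by a
  Martin-Loef test, and yet it cannot exhaust the positive measure of the sequences that satisfy the
  complexity bound, since the strings of length at least \<open>t\<close> violating it have total measure below
  \<open>\<epsilon> * 2^-j\<close>. Iterating this gives a non-random sequence that satisfies the bound.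
\<close>

section \<open>Computable functions and decidable predicates\<close>

text \<open>The obstacle is effectivity. That the part of the sum still missing is small compared
  with the description mass still missing is never confirmed at a finite stage, while a Martin-Loef
  test must be enumerable. The construction therefore works with guesses: every checkpoint is a
  guess that the tail of the sum from there on is small, measured against the growth of the
  description mass since the previous checkpoint. A refuted guess stays in the test, but its price
  is charged to that growth, and all growths together telescope to at most 1. Because
  \<open>f - K\<close> tends to infinity the guesses come to an end, and the last one is right. The
  factor \<open>4^-D\<close> is spent in two halves: one \<open>2^-D\<close> makes the total price
  of level \<open>D\<close> small, the other is the \<open>\<epsilon>\<close> of the last guess.

  In the divergent case no sequence satisfies the bound, which contradicts the hypothesis only
  because some sequence is random. There the additive constants, including that of simulation by
  \<open>U\<close>, are absorbed by a computable \<open>g\<close> with \<open>g - f\<close> tending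
  to infinity and the sum of \<open>2^-g(n)\<close> still divergent.\<close>

lemma computable_const: "computable (\<lambda>_. c)"
  unfolding computable_def by (rule partrec_const)

lemma computable_fst0: "computable (\<lambda>x. fst (prod_decode x))"
  unfolding computable_def by (rule partrec.left)

lemma computable_snd0: "computable (\<lambda>x. snd (prod_decode x))"
  unfolding computable_def by (rule partrec.right)

lemma computable_compose:
  assumes "computable f" "computable g"
  shows "computable (\<lambda>x. f (g x))"
  using partrec.comp[OF assms[unfolded computable_def]] by (simp add: computable_def)

lemma computable_pair:
  assumes "computable f" "computable g"
  shows "computable (\<lambda>x. prod_encode (f x, g x))"
  using partrec.pair[OF assms[unfolded computable_def]] by (simp add: computable_def)

lemma computable_id: "computable (\<lambda>x. x)"
  using computable_pair[OF computable_fst0 computable_snd0] by simp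

lemmas computable_fst = computable_compose[OF computable_fst0]
lemmas computable_snd = computable_compose[OF computable_snd0]

lemma computable_Suc:
  assumes "computable f"
  shows "computable (\<lambda>x. Suc (f x))"
  using computable_compose[OF partrec.succ[folded computable_def] assms] .

lemma computable2_apply:
  assumes "computable2 h" "computable f" "computable g"
  shows "computable (\<lambda>x. h (f x) (g x))"
  using computable_compose[OF assms(1)[unfolded computable2_def, folded computable_def]
      computable_pair[OF assms(2,3)]] by simp

lemma computable2I:
  assumes "computable (\<lambda>e. h (fst (prod_decode e)) (snd (prod_decode e)))"
  shows "computable2 h"
  using assms by (simp add: computable_def computable2_def)

lemma computable_rec:
  assumes z: "computable z"
    and s: "computable (\<lambda>e. s (fst (prod_decode e)) (fst (prod_decode (snd (prod_decode e))))
      (snd (prod_decode (snd (prod_decode e)))))"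
    and b: "computable b"
  shows "computable (\<lambda>x. rec_nat (z x) (s x) (b x))"
proof -
  let ?s = "\<lambda>e. Some (s (fst (prod_decode e)) (fst (prod_decode (snd (prod_decode e))))
      (snd (prod_decode (snd (prod_decode e)))))"
  have it: "iterate (\<lambda>x. Some (z x)) ?s a k = Some (rec_nat (z a) (s a) k)" for a k
    by (induction k) simp_all
  have "computable (\<lambda>e. rec_nat (z (fst (prod_decode e))) (s (fst (prod_decode e))) (snd (prod_decode e)))"
    using partrec.prec[OF z[unfolded computable_def] s[unfolded computable_def]]
    unfolding it computable_def .
  from computable_compose[OF this computable_pair[OF computable_id b]]
  show ?thesis by simp
qed

named_theorems comp_intros

declare computable_const[comp_intros] computable_id[comp_intros] computable_fst[comp_intros]
  computable_snd[comp_intros] computable_Suc[comp_intros] computable_pair[comp_intros]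

lemma computable_add[comp_intros]:
  assumes "computable f" "computable g"
  shows "computable (\<lambda>x. f x + g x)"
proof -
  have "computable (\<lambda>x. rec_nat (f x) (\<lambda>_ r. Suc r) (g x))"
    by (intro computable_rec assms comp_intros)
  moreover have "rec_nat a (\<lambda>_ r. Suc r) n = a + n" for a n by (induction n) auto
  ultimately show ?thesis by simp
qed

lemma computable_sum[comp_intros]:
  assumes "computable (\<lambda>e. F (fst (prod_decode e)) (snd (prod_decode e)))" "computable b"
  shows "computable (\<lambda>x. \<Sum>i<b x. F x i)"
proof -
  have "computable (\<lambda>x. rec_nat 0 (\<lambda>i r. r + F x i) (b x))"
    by (intro computable_rec assms comp_intros computable2_apply[of F] computable2I)
  moreover have "rec_nat 0 (\<lambda>i r. r + F x i) n = (\<Sum>i<n. F x i)" for x n by (induction n) auto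
  ultimately show ?thesis by simp
qed

lemma computable_mult[comp_intros]:
  assumes "computable f" "computable g"
  shows "computable (\<lambda>x. f x * g x)"
proof -
  have "computable (\<lambda>x. \<Sum>i<f x. g x)"
    by (intro comp_intros computable_compose[OF assms(2)] assms)
  then show ?thesis by simp
qed

lemma computable_prod[comp_intros]:
  assumes "computable (\<lambda>e. F (fst (prod_decode e)) (snd (prod_decode e)))" "computable b"
  shows "computable (\<lambda>x. \<Prod>i<b x. F x i)"
proof -
  have "computable (\<lambda>x. rec_nat 1 (\<lambda>i r. r * F x i) (b x))"
    by (intro computable_rec assms comp_intros computable2_apply[of F] computable2I)
  moreover have "rec_nat 1 (\<lambda>i r. r * F x i) n = (\<Prod>i<n. F x i)" for x n by (induction n) auto
  ultimately show ?thesis by simp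
qed

lemma computable_power[comp_intros]:
  assumes "computable f" "computable g"
  shows "computable (\<lambda>x. f x ^ g x)"
proof -
  have "computable (\<lambda>x. \<Prod>i<g x. f x)"
    by (intro comp_intros computable_compose[OF assms(1)] assms)
  then show ?thesis by simp
qed

lemma computable_diff[comp_intros]:
  assumes "computable f" "computable g"
  shows "computable (\<lambda>x. f x - g x)"
proof -
  have "computable (\<lambda>x. rec_nat 0 (\<lambda>i r. i) x)"
    by (intro computable_rec comp_intros)
  moreover have "rec_nat 0 (\<lambda>i r. i) n = n - 1" for n by (cases n) auto
  ultimately have pred: "computable (\<lambda>x. x - 1)" by simp
  have "computable (\<lambda>x. rec_nat (f x) (\<lambda>i r. r - 1) (g x))"
    by (intro computable_rec comp_intros assms computable_compose[OF pred])
  moreover have "rec_nat a (\<lambda>i r. r - 1) n = a - n" for a n :: nat by (induction n) auto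
  ultimately show ?thesis by simp
qed

section \<open>Decidable predicates, division and search\<close>

definition dec :: "(nat \<Rightarrow> bool) \<Rightarrow> bool" where
  "dec P \<longleftrightarrow> computable (\<lambda>x. of_bool (P x))"

lemma dec_le[comp_intros]:
  assumes "computable f" "computable g"
  shows "dec (\<lambda>x. f x \<le> g x)"
proof -
  have "computable (\<lambda>x. 1 - (f x - g x))"
    by (intro comp_intros assms)
  moreover have "(\<lambda>x. of_bool (f x \<le> g x)) = (\<lambda>x. 1 - (f x - g x))" by auto
  ultimately show ?thesis by (simp add: dec_def)
qed

lemma dec_not[comp_intros]:
  assumes "dec P"
  shows "dec (\<lambda>x. \<not> P x)"
proof -
  have "computable (\<lambda>x. 1 - of_bool (P x))"
    by (intro comp_intros assms[unfolded dec_def])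
  moreover have "(\<lambda>x. of_bool (\<not> P x)) = (\<lambda>x. 1 - of_bool (P x) :: nat)" by auto
  ultimately show ?thesis by (simp add: dec_def)
qed

lemma dec_conj[comp_intros]:
  assumes "dec P" "dec Q"
  shows "dec (\<lambda>x. P x \<and> Q x)"
proof -
  have "computable (\<lambda>x. of_bool (P x) * of_bool (Q x))"
    by (intro comp_intros assms[unfolded dec_def])
  moreover have "(\<lambda>x. of_bool (P x \<and> Q x)) = (\<lambda>x. of_bool (P x) * of_bool (Q x) :: nat)" by auto
  ultimately show ?thesis by (simp add: dec_def)
qed

lemma dec_disj[comp_intros]:
  assumes "dec P" "dec Q"
  shows "dec (\<lambda>x. P x \<or> Q x)"
  using dec_not[OF dec_conj[OF dec_not[OF assms(1)] dec_not[OF assms(2)]]] by simp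

lemma dec_less[comp_intros]:
  assumes "computable f" "computable g"
  shows "dec (\<lambda>x. f x < g x)"
  using dec_not[OF dec_le[OF assms(2,1)]] by (simp add: not_le)

lemma dec_eq[comp_intros]:
  assumes "computable f" "computable g"
  shows "dec (\<lambda>x. f x = g x)"
  using dec_conj[OF dec_le[OF assms] dec_le[OF assms(2,1)]] by (simp add: eq_iff)

lemma dec_compose:
  assumes "dec P" "computable f"
  shows "dec (\<lambda>x. P (f x))"
  using computable_compose[OF assms(1)[unfolded dec_def] assms(2)] by (simp add: dec_def)

lemma dec_bex[comp_intros]:
  assumes "dec (\<lambda>e. P (fst (prod_decode e)) (snd (prod_decode e)))" "computable b"
  shows "dec (\<lambda>x. \<exists>i<b x. P x i)"
proof -
  have "dec (\<lambda>x. 0 < (\<Sum>i<b x. of_bool (P x i) :: nat))"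
    by (intro comp_intros assms assms(1)[unfolded dec_def])
  moreover have "(\<lambda>x. 0 < (\<Sum>i<b x. of_bool (P x i) :: nat)) = (\<lambda>x. \<exists>i<b x. P x i)"
    by (auto simp: zero_less_iff_neq_zero)
  ultimately show ?thesis by simp
qed

lemma dec_ball[comp_intros]:
  assumes "dec (\<lambda>e. P (fst (prod_decode e)) (snd (prod_decode e)))" "computable b"
  shows "dec (\<lambda>x. \<forall>i<b x. P x i)"
  using dec_not[OF dec_bex[OF dec_not[OF assms(1)] assms(2)]] by simp

lemma computable_if[comp_intros]:
  assumes "dec P" "computable f" "computable g"
  shows "computable (\<lambda>x. if P x then f x else g x)"
proof -
  have "computable (\<lambda>x. of_bool (P x) * f x + of_bool (\<not> P x) * g x)"
    by (intro comp_intros assms assms(1)[unfolded dec_def] dec_not[unfolded dec_def])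
  then show ?thesis by (rule back_subst[of computable]) auto
qed

lemma computable_max[comp_intros]:
  assumes "computable f" "computable g"
  shows "computable (\<lambda>x. max (f x) (g x))"
  unfolding max_def by (intro comp_intros assms)

lemma computable_div[comp_intros]:
  assumes "computable f" "computable g"
  shows "computable (\<lambda>x. f x div g x)"
proof -
  have "computable (\<lambda>x. if g x = 0 then 0 else \<Sum>i<f x. if Suc i * g x \<le> f x then 1 else 0)"
    by (intro comp_intros assms computable_compose[OF assms(1)] computable_compose[OF assms(2)])
  \<comment> \<open>The quotient counts the positive multiples of \<open>b\<close> that do not
    exceed \<open>a\<close>.\<close>
  moreover have "a div b = (if b = 0 then 0 else \<Sum>i<a. if Suc i * b \<le> a then 1 else 0)" for a b :: nat
  proof (cases "b = 0")
    case False
    have "i < a \<and> Suc i * b \<le> a \<longleftrightarrow> i < a div b" for i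
    proof -
      have "Suc i * b \<le> a \<longleftrightarrow> i < a div b"
        using False by (simp add: less_eq_div_iff_mult_less_eq Suc_le_eq[symmetric] del: mult_Suc)
      moreover have "a div b \<le> a" by (rule div_le_dividend)
      ultimately show ?thesis by linarith
    qed
    then have "{i. i < a \<and> Suc i * b \<le> a} = {..<a div b}" by auto
    then have "card {i. i < a \<and> Suc i * b \<le> a} = a div b" by simp
    moreover have "(\<Sum>i<a. if Suc i * b \<le> a then 1 else 0) = card {i. i < a \<and> Suc i * b \<le> a}"
      by (simp add: sum.If_cases Int_def del: mult_Suc)
    ultimately show ?thesis using False by simp
  qed simp
  ultimately show ?thesis by (simp del: mult_Suc)
qed

lemma computable_mod[comp_intros]:
  assumes "computable f" "computable g"
  shows "computable (\<lambda>x. f x mod g x)"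
  unfolding modulo_nat_def by (intro comp_intros assms)

lemma dec_odd[comp_intros]:
  assumes "computable f"
  shows "dec (\<lambda>x. odd (f x))"
  unfolding odd_iff_mod_2_eq_one by (intro comp_intros assms)

lemma partrec_search:
  assumes "dec (\<lambda>e. P (fst (prod_decode e)) (snd (prod_decode e)))"
  shows "partrec (\<lambda>x. if \<exists>n. P x n then Some (LEAST n. P x n) else None)"
proof -
  have "computable (\<lambda>e. of_bool (\<not> P (fst (prod_decode e)) (snd (prod_decode e))))"
    using dec_not[OF assms] by (simp add: dec_def)
  from partrec.search[OF this[unfolded computable_def]]
  have "partrec (\<lambda>x. minimize (\<lambda>n. Some (of_bool (\<not> P x n))))" by simp
  moreover have "Some (of_bool (\<not> P x n)) = Some (0::nat) \<longleftrightarrow> P x n" for x n by simp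
  ultimately show ?thesis unfolding minimize_def by (simp cong: if_cong)
qed

lemma computable_Least:
  assumes "dec (\<lambda>e. P (fst (prod_decode e)) (snd (prod_decode e)))" "\<And>x. \<exists>n. P x n"
  shows "computable (\<lambda>x. LEAST n. P x n)"
  using partrec_search[OF assms(1)] assms(2) by (simp add: computable_def)

lemma ce_exists:
  assumes "dec (\<lambda>e. P (fst (prod_decode e)) (snd (prod_decode e)))"
  shows "ce {x. \<exists>n. P x n}"
  unfolding ce_def
  by (rule exI, rule conjI[OF partrec_search[OF assms]]) (auto simp: dom_def)

section \<open>Rational-valued computable functions\<close>

definition rat_computable :: "(nat \<Rightarrow> real) \<Rightarrow> bool" where
  "rat_computable r \<longleftrightarrow> (\<exists>a b. computable a \<and> computable b \<and>
    (\<forall>x. 0 < b x \<and> r x = real (a x) / real (b x)))"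

lemma rat_computableI:
  assumes "computable a" "computable b" "\<And>x. 0 < b x" "\<And>x. r x = real (a x) / real (b x)"
  shows "rat_computable r"
  using assms unfolding rat_computable_def by blast

lemma rat_compose:
  assumes "rat_computable r" "computable f"
  shows "rat_computable (\<lambda>x. r (f x))"
proof -
  obtain a b where ab: "computable a" "computable b" "\<And>x. 0 < b x" "\<And>x. r x = real (a x) / real (b x)"
    using assms(1) unfolding rat_computable_def by blast
  show ?thesis
    by (rule rat_computableI[OF computable_compose[OF ab(1) assms(2)] computable_compose[OF ab(2) assms(2)]])
      (simp_all add: ab)
qed

lemma rat_compose2:
  assumes "rat_computable (\<lambda>e. r (fst (prod_decode e)) (snd (prod_decode e)))" "computable f" "computable g"
  shows "rat_computable (\<lambda>x. r (f x) (g x))"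
  using rat_compose[OF assms(1) computable_pair[OF assms(2,3)]] by simp

lemma rat_of_nat[comp_intros]:
  assumes "computable f"
  shows "rat_computable (\<lambda>x. real (f x))"
  by (rule rat_computableI[OF assms computable_const[of 1]]) simp_all

lemma rat_add[comp_intros]:
  assumes "rat_computable r" "rat_computable s"
  shows "rat_computable (\<lambda>x. r x + s x)"
proof -
  obtain a b where ab: "computable a" "computable b" "\<And>x. 0 < b x" "\<And>x. r x = real (a x) / real (b x)"
    using assms(1) unfolding rat_computable_def by blast
  obtain c d where cd: "computable c" "computable d" "\<And>x. 0 < d x" "\<And>x. s x = real (c x) / real (d x)"
    using assms(2) unfolding rat_computable_def by blast
  show ?thesis
    by (rule rat_computableI[of "\<lambda>x. a x * d x + c x * b x" "\<lambda>x. b x * d x"])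
      (use ab(3) cd(3) in \<open>auto intro!: comp_intros ab cd simp: ab(4) cd(4) field_simps\<close>)
qed

lemma rat_mult[comp_intros]:
  assumes "rat_computable r" "rat_computable s"
  shows "rat_computable (\<lambda>x. r x * s x)"
proof -
  obtain a b where ab: "computable a" "computable b" "\<And>x. 0 < b x" "\<And>x. r x = real (a x) / real (b x)"
    using assms(1) unfolding rat_computable_def by blast
  obtain c d where cd: "computable c" "computable d" "\<And>x. 0 < d x" "\<And>x. s x = real (c x) / real (d x)"
    using assms(2) unfolding rat_computable_def by blast
  show ?thesis
    by (rule rat_computableI[of "\<lambda>x. a x * c x" "\<lambda>x. b x * d x"])
      (use ab(3) cd(3) in \<open>auto intro!: comp_intros ab cd simp: ab(4) cd(4)\<close>)
qed

lemma rat_half_power[comp_intros]: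
  assumes "computable f"
  shows "rat_computable (\<lambda>x. (1/2) ^ f x)"
  by (rule rat_computableI[of "\<lambda>x. 1" "\<lambda>x. 2 ^ f x"])
    (auto intro!: comp_intros assms simp: power_one_over)

lemma dec_rat_le[comp_intros]:
  assumes "rat_computable r" "rat_computable s"
  shows "dec (\<lambda>x. r x \<le> s x)"
proof -
  obtain a b where ab: "computable a" "computable b" "\<And>x. 0 < b x" "\<And>x. r x = real (a x) / real (b x)"
    using assms(1) unfolding rat_computable_def by blast
  obtain c d where cd: "computable c" "computable d" "\<And>x. 0 < d x" "\<And>x. s x = real (c x) / real (d x)"
    using assms(2) unfolding rat_computable_def by blast
  have "dec (\<lambda>x. a x * d x \<le> c x * b x)"
    by (intro comp_intros ab cd)
  moreover have "r x \<le> s x \<longleftrightarrow> a x * d x \<le> c x * b x" for x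
  proof -
    have "r x \<le> s x \<longleftrightarrow> real (a x) * real (d x) \<le> real (c x) * real (b x)"
      using ab(3)[of x] cd(3)[of x] by (simp add: ab(4) cd(4) field_simps)
    then show ?thesis by (simp flip: of_nat_mult)
  qed
  ultimately show ?thesis by simp
qed

lemma dec_rat_less[comp_intros]:
  assumes "rat_computable r" "rat_computable s"
  shows "dec (\<lambda>x. r x < s x)"
  using dec_not[OF dec_rat_le[OF assms(2,1)]] by (simp add: not_le)

lemma rat_if[comp_intros]:
  assumes "dec P" "rat_computable r" "rat_computable s"
  shows "rat_computable (\<lambda>x. if P x then r x else s x)"
proof -
  obtain a b where ab: "computable a" "computable b" "\<And>x. 0 < b x" "\<And>x. r x = real (a x) / real (b x)"
    using assms(2) unfolding rat_computable_def by blast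
  obtain c d where cd: "computable c" "computable d" "\<And>x. 0 < d x" "\<And>x. s x = real (c x) / real (d x)"
    using assms(3) unfolding rat_computable_def by blast
  show ?thesis
    by (rule rat_computableI[of "\<lambda>x. if P x then a x else c x" "\<lambda>x. if P x then b x else d x"])
      (use ab(3) cd(3) in \<open>auto intro!: comp_intros assms(1) ab cd simp: ab(4) cd(4)\<close>)
qed

lemma rat_min[comp_intros]:
  assumes "rat_computable r" "rat_computable s"
  shows "rat_computable (\<lambda>x. min (r x) (s x))"
  unfolding min_def by (intro comp_intros assms)

lemma rat_sum[comp_intros]:
  assumes "rat_computable (\<lambda>e. F (fst (prod_decode e)) (snd (prod_decode e)))" "computable n"
  shows "rat_computable (\<lambda>x. \<Sum>i<n x. F x i)"
proof -
  obtain a b where ab: "computable a" "computable b" "\<And>x. 0 < b x"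
    "\<And>e. F (fst (prod_decode e)) (snd (prod_decode e)) = real (a e) / real (b e)"
    using assms(1) unfolding rat_computable_def by blast
  \<comment> \<open>The product of all denominators serves as common denominator, so the divisions
    in \<open>?N\<close> are exact.\<close>
  let ?D = "\<lambda>x. \<Prod>i<n x. b (prod_encode (x, i))"
  let ?N = "\<lambda>x. \<Sum>i<n x. a (prod_encode (x, i)) * (?D x div b (prod_encode (x, i)))"
  have "computable ?D" "computable ?N"
    by (intro comp_intros assms(2) computable_compose[OF ab(1)] computable_compose[OF ab(2)]
        computable_compose[OF assms(2)])+
  moreover have "0 < ?D x" for x by (simp add: ab(3))
  moreover have "(\<Sum>i<n x. F x i) = real (?N x) / real (?D x)" for x
  proof -
    have "F x i = real (a (prod_encode (x, i)) * (?D x div b (prod_encode (x, i)))) / real (?D x)"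
      if "i < n x" for i
    proof -
      have "b (prod_encode (x, i)) dvd ?D x" using that by (intro dvd_prodI) auto
      then have "real (?D x div b (prod_encode (x, i))) = real (?D x) / real (b (prod_encode (x, i)))"
        by (rule real_of_nat_div)
      then show ?thesis
        using ab(4)[of "prod_encode (x, i)"] \<open>0 < ?D x\<close> by (simp del: of_nat_prod)
    qed
    then show ?thesis by (simp add: sum_divide_distrib del: of_nat_prod of_nat_mult)
  qed
  ultimately show ?thesis by (intro rat_computableI[of ?N ?D])
qed

section \<open>Stage approximations of partial recursive functions\<close>

text \<open>The value 0 means that there is no result yet, and \<open>Suc v\<close> reports the
  result \<open>v\<close>. Reports are always correct, and they become permanent only eventually;
  monotonicity in \<open>t\<close> is not part of the notion.\<close>

definition clocks :: "(nat \<Rightarrow> nat \<Rightarrow> nat) \<Rightarrow> (nat \<rightharpoonup> nat) \<Rightarrow> bool" where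
  "clocks h g \<longleftrightarrow> (\<forall>n. (\<forall>t v. h n t = Suc v \<longrightarrow> g n = Some v) \<and>
    (\<forall>v. g n = Some v \<longrightarrow> (\<forall>\<^sub>F t in sequentially. h n t = Suc v)))"

lemma clocksI:
  assumes "\<And>n t v. h n t = Suc v \<Longrightarrow> g n = Some v"
    and "\<And>n v. g n = Some v \<Longrightarrow> \<forall>\<^sub>F t in sequentially. h n t = Suc v"
  shows "clocks h g"
  using assms unfolding clocks_def by blast

lemma clocks_sound: "clocks h g \<Longrightarrow> h n t = Suc v \<Longrightarrow> g n = Some v"
  unfolding clocks_def by blast

lemma clocks_complete: "clocks h g \<Longrightarrow> g n = Some v \<Longrightarrow> \<forall>\<^sub>F t in sequentially. h n t = Suc v"
  unfolding clocks_def by blast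

lemma clocked_total:
  assumes "computable f"
  shows "\<exists>h. computable2 h \<and> clocks h (\<lambda>n. Some (f n))"
  by (rule exI[of _ "\<lambda>n _. Suc (f n)"])
    (auto simp: clocks_def intro!: computable2I comp_intros computable_compose[OF assms])

lemma partrec_clocked:
  assumes "partrec g"
  shows "\<exists>h. computable2 h \<and> clocks h g"
  using assms
proof induction
  case zero
  show ?case by (intro clocked_total comp_intros)
next
  case succ
  show ?case by (intro clocked_total comp_intros)
next
  case left
  show ?case by (intro clocked_total comp_intros)
next
  case right
  show ?case by (intro clocked_total comp_intros)
next
  case (pair f g)
  then obtain h k where h: "computable2 h" "clocks h f" and k: "computable2 k" "clocks k g" by blast
  let ?c = "\<lambda>n t. if h n t = 0 \<or> k n t = 0 then 0 else Suc (prod_encode (h n t - 1, k n t - 1))"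
  have "computable2 ?c"
    by (intro computable2I comp_intros computable2_apply[OF h(1)] computable2_apply[OF k(1)])
  moreover have "clocks ?c (\<lambda>n. Option.bind (f n) (\<lambda>a. Option.bind (g n) (\<lambda>b. Some (prod_encode (a, b)))))"
  proof (rule clocksI)
    fix n t v
    assume c: "?c n t = Suc v"
    then obtain a b where ab: "h n t = Suc a" "k n t = Suc b"
      by (cases "h n t"; cases "k n t") auto
    with c clocks_sound[OF h(2) ab(1)] clocks_sound[OF k(2) ab(2)]
    show "Option.bind (f n) (\<lambda>a. Option.bind (g n) (\<lambda>b. Some (prod_encode (a, b)))) = Some v"
      by simp
  next
    fix n v
    assume "Option.bind (f n) (\<lambda>a. Option.bind (g n) (\<lambda>b. Some (prod_encode (a, b)))) = Some v"
    then obtain a b where ab: "f n = Some a" "g n = Some b" "v = prod_encode (a, b)"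
      by (auto simp: bind_eq_Some_conv)
    from clocks_complete[OF h(2) ab(1)] clocks_complete[OF k(2) ab(2)]
    show "\<forall>\<^sub>F t in sequentially. ?c n t = Suc v"
      by eventually_elim (simp add: ab(3))
  qed
  ultimately show ?case by blast
next
  case (comp f g)
  then obtain h k where h: "computable2 h" "clocks h f" and k: "computable2 k" "clocks k g" by blast
  let ?c = "\<lambda>n t. if k n t = 0 then 0 else h (k n t - 1) t"
  have "computable2 ?c"
    by (intro computable2I comp_intros computable2_apply[OF h(1)] computable2_apply[OF k(1)])
  moreover have "clocks ?c (\<lambda>n. Option.bind (g n) f)"
  proof (rule clocksI)
    fix n t v
    assume c: "?c n t = Suc v"
    then obtain b where b: "k n t = Suc b" by (cases "k n t") auto
    with c clocks_sound[OF k(2) b] clocks_sound[OF h(2), of b t v]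
    show "Option.bind (g n) f = Some v" by simp
  next
    fix n v
    assume "Option.bind (g n) f = Some v"
    then obtain b where b: "g n = Some b" "f b = Some v" by (auto simp: bind_eq_Some_conv)
    from clocks_complete[OF k(2) b(1)] clocks_complete[OF h(2) b(2)]
    show "\<forall>\<^sub>F t in sequentially. ?c n t = Suc v"
      by eventually_elim simp
  qed
  ultimately show ?case by blast
next
  case (prec f g)
  then obtain h k where h: "computable2 h" "clocks h f" and k: "computable2 k" "clocks k g" by blast
  define c where "c a t m = rec_nat (h a t)
    (\<lambda>i r. if r = 0 then 0 else k (prod_encode (a, prod_encode (i, r - 1))) t) m" for a t m
  have "computable2 (\<lambda>n t. c (fst (prod_decode n)) t (snd (prod_decode n)))"
    unfolding c_def
    by (intro computable2I computable_rec comp_intros computable2_apply[OF h(1)] computable2_apply[OF k(1)])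
  moreover have sound: "iterate f g a m = Some v" if "c a t m = Suc v" for a t m v
    using that
  proof (induction m arbitrary: v)
    case 0
    then show ?case using clocks_sound[OF h(2), of a t v] by (simp add: c_def)
  next
    case (Suc m)
    then obtain r where r: "c a t m = Suc r" by (cases "c a t m") (auto simp: c_def)
    with Suc.prems have "k (prod_encode (a, prod_encode (m, r))) t = Suc v" by (simp add: c_def)
    with clocks_sound[OF k(2) this] Suc.IH[OF r] show ?case by simp
  qed
  moreover have compl: "\<forall>\<^sub>F t in sequentially. c a t m = Suc v" if "iterate f g a m = Some v" for a m v
    using that
  proof (induction m arbitrary: v)
    case 0
    then show ?case using clocks_complete[OF h(2), of a v] by (simp add: c_def)
  next
    case (Suc m)
    then obtain r where r: "iterate f g a m = Some r" "g (prod_encode (a, prod_encode (m, r))) = Some v"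
      by (auto simp: bind_eq_Some_conv)
    from Suc.IH[OF r(1)] clocks_complete[OF k(2) r(2)] show ?case
      by eventually_elim (simp add: c_def)
  qed
  ultimately show ?case
    by (intro exI[of _ "\<lambda>n t. c (fst (prod_decode n)) t (snd (prod_decode n))"] conjI clocksI)
next
  case (search f)
  then obtain h where h: "computable2 h" "clocks h f" by blast
  \<comment> \<open>The bounded search halts at the first \<open>n\<close> whose computation is
    unfinished (0) or has result 0 (1). Only the value 1 counts as success, since then all earlier
    results are known and positive.\<close>
  let ?L = "\<lambda>a t. LEAST n. t \<le> n \<or> h (prod_encode (a, n)) t \<le> 1"
  let ?c = "\<lambda>a t. if ?L a t < t \<and> h (prod_encode (a, ?L a t)) t = 1 then Suc (?L a t) else 0"
  have L: "computable2 ?L"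
  proof (rule computable2I)
    have "computable (\<lambda>e. LEAST n. snd (prod_decode e) \<le> n \<or>
      h (prod_encode (fst (prod_decode e), n)) (snd (prod_decode e)) \<le> 1)"
      by (rule computable_Least) (auto intro!: comp_intros computable2_apply[OF h(1)])
    then show "computable (\<lambda>e. ?L (fst (prod_decode e)) (snd (prod_decode e)))" .
  qed
  have "computable2 ?c"
    by (intro computable2I comp_intros computable2_apply[OF h(1)] computable2_apply[OF L])
  moreover have "clocks ?c (\<lambda>a. minimize (\<lambda>n. f (prod_encode (a, n))))"
  proof (rule clocksI)
    fix a t v
    assume c: "?c a t = Suc v"
    then have v: "v = ?L a t" "v < t" "h (prod_encode (a, v)) t = Suc 0"
      by (auto split: if_splits)
    have fv: "f (prod_encode (a, v)) = Some 0" using clocks_sound[OF h(2) v(3)] .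
    have less: "\<exists>w. f (prod_encode (a, m)) = Some (Suc w)" if "m < v" for m
    proof -
      have "\<not> (t \<le> m \<or> h (prod_encode (a, m)) t \<le> 1)"
        using that unfolding v(1) by (rule not_less_Least)
      then obtain w where "h (prod_encode (a, m)) t = Suc (Suc w)"
        by (metis One_nat_def Suc_le_eq not_less not_less_eq_eq old.nat.exhaust le_0_eq not0_implies_Suc)
      then show ?thesis using clocks_sound[OF h(2)] by blast
    qed
    have "(LEAST n. f (prod_encode (a, n)) = Some 0) = v"
      using fv by (intro Least_equality) (metis less linorder_not_less nat.distinct(1) option.inject)+
    moreover have "\<exists>n. f (prod_encode (a, n)) = Some 0 \<and> (\<forall>m<n. f (prod_encode (a, m)) \<noteq> None)"
      using fv less by fastforce
    ultimately show "minimize (\<lambda>n. f (prod_encode (a, n))) = Some v"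
      by (simp add: minimize_def)
  next
    fix a v
    assume "minimize (\<lambda>n. f (prod_encode (a, n))) = Some v"
    then obtain n where n: "f (prod_encode (a, n)) = Some 0" "\<And>m. m < n \<Longrightarrow> f (prod_encode (a, m)) \<noteq> None"
      and v: "v = (LEAST n. f (prod_encode (a, n)) = Some 0)"
      by (auto simp: minimize_def split: if_splits)
    have fv: "f (prod_encode (a, v)) = Some 0"
      unfolding v using n(1) by (rule LeastI)
    have "v \<le> n" unfolding v using n(1) by (rule Least_le)
    have "\<exists>w. f (prod_encode (a, m)) = Some (Suc w)" if "m < v" for m
    proof -
      have "f (prod_encode (a, m)) \<noteq> Some 0"
        using that unfolding v by (rule not_less_Least)
      moreover have "f (prod_encode (a, m)) \<noteq> None" using n(2) that \<open>v \<le> n\<close> by simp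
      ultimately show ?thesis by (metis not_None_eq not0_implies_Suc)
    qed
    then have "\<forall>m\<in>{..<v}. \<forall>\<^sub>F t in sequentially. 1 < h (prod_encode (a, m)) t"
    proof (intro ballI)
      fix m assume "m \<in> {..<v}"
      assume "\<And>m. m < v \<Longrightarrow> \<exists>w. f (prod_encode (a, m)) = Some (Suc w)"
      then obtain w where "f (prod_encode (a, m)) = Some (Suc w)" using \<open>m \<in> {..<v}\<close> by blast
      from clocks_complete[OF h(2) this] show "\<forall>\<^sub>F t in sequentially. 1 < h (prod_encode (a, m)) t"
        by eventually_elim simp
    qed
    then have "\<forall>\<^sub>F t in sequentially. \<forall>m\<in>{..<v}. 1 < h (prod_encode (a, m)) t"
      by (intro eventually_ball_finite) auto
    with clocks_complete[OF h(2) fv] eventually_gt_at_top[of v]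
    show "\<forall>\<^sub>F t in sequentially. ?c a t = Suc v"
    proof eventually_elim
      case (elim t)
      have "?L a t = v"
        by (rule Least_equality) (use elim in \<open>fastforce simp: not_less[symmetric]\<close>)+
      then show ?case using elim by simp
    qed
  qed
  ultimately show ?case by blast
qed

section \<open>Binary strings\<close>

lemma str_of_nat_of_str[simp]: "str_of_nat (nat_of_str s) = s"
  unfolding str_of_nat_def by (simp add: bij_is_inj[OF bij_nat_of_str])

lemma nat_of_str_of_nat[simp]: "nat_of_str (str_of_nat n) = n"
  unfolding str_of_nat_def by (simp add: bij_is_surj[OF bij_nat_of_str] surj_f_inv_f)

text \<open>\<open>nat_of_str s + 1\<close> is an ordinary binary number: the bits of
  \<open>s\<close>, least significant first, topped by a leading 1. This gives the length here and
  the single bits in \<open>nth_iff_odd\<close>.\<close>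

lemma nat_of_str_bounds: "2 ^ length s \<le> nat_of_str s + 1 \<and> nat_of_str s + 1 < 2 ^ Suc (length s)"
  by (induction s) auto

lemma length_str_of_nat: "length (str_of_nat c) = (LEAST l. c + 1 < 2 ^ Suc l)"
proof (rule Least_equality[symmetric])
  show "c + 1 < 2 ^ Suc (length (str_of_nat c))"
    using nat_of_str_bounds[of "str_of_nat c"] by simp
next
  fix l
  assume "c + 1 < 2 ^ Suc l"
  moreover have "2 ^ length (str_of_nat c) \<le> c + 1"
    using nat_of_str_bounds[of "str_of_nat c"] by simp
  ultimately have "(2::nat) ^ length (str_of_nat c) < 2 ^ Suc l" by linarith
  then show "length (str_of_nat c) \<le> l" by (simp add: power_strict_increasing_iff del: power_Suc)
qed

lemma computable_length:
  assumes "computable f"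
  shows "computable (\<lambda>x. length (str_of_nat (f x)))"
proof -
  have "computable (\<lambda>c. LEAST l. c + 1 < 2 ^ Suc l)"
  proof (rule computable_Least)
    fix c :: nat
    show "\<exists>l. c + 1 < 2 ^ Suc l"
      using nat_of_str_bounds[of "str_of_nat c"] by auto
  qed (intro comp_intros)
  from computable_compose[OF this assms] show ?thesis by (simp add: length_str_of_nat)
qed

lemma nth_iff_odd:
  "i < length s \<Longrightarrow> s ! i \<longleftrightarrow> odd ((nat_of_str s + 1) div 2 ^ i)"
proof (induction s arbitrary: i)
  case (Cons b s)
  have "(nat_of_str (b # s) + 1) div 2 = nat_of_str s + 1" by simp
  then show ?case
    using Cons by (cases i) (auto simp: div_mult2_eq)
qed simp

lemma dec_nth:
  assumes "computable f" "computable g"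
  shows "dec (\<lambda>x. g x < length (str_of_nat (f x)) \<and> str_of_nat (f x) ! g x)"
proof -
  have "dec (\<lambda>x. g x < length (str_of_nat (f x)) \<and> odd ((f x + 1) div 2 ^ g x))"
    by (intro comp_intros computable_length assms)
  then show ?thesis
    by (rule back_subst[of dec]) (auto simp: nth_iff_odd)
qed

text \<open>\<open>nat_of_str\<close> makes the first bit the least significant one. For strings to
  denote dyadic intervals that shrink under extension, the first bit has to be the most
  significant.\<close>

fun big_endian :: "bool list \<Rightarrow> nat" where
  "big_endian [] = 0"
| "big_endian (b # s) = of_bool b * 2 ^ length s + big_endian s"

lemma big_endian_append: "big_endian (s @ t) = big_endian s * 2 ^ length t + big_endian t"
  by (induction s) (auto simp: power_add algebra_simps)

lemma big_endian_less: "big_endian s < 2 ^ length s"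
  by (induction s) auto

lemma big_endian_sum: "big_endian s = (\<Sum>i<length s. of_bool (s ! i) * 2 ^ (length s - Suc i))"
  by (induction s) (simp_all add: sum.lessThan_Suc_shift del: sum.lessThan_Suc sum_of_bool_mult_eq sum_mult_of_bool_eq)

lemma big_endian_inj: "length s = length t \<Longrightarrow> big_endian s = big_endian t \<Longrightarrow> s = t"
proof (induction s t rule: list_induct2)
  case (Cons b s c t)
  have "big_endian s < 2 ^ length t" "big_endian t < 2 ^ length t"
    using big_endian_less[of s] big_endian_less[of t] Cons.hyps by simp_all
  then have "b = c" using Cons.prems Cons.hyps by (cases b; cases c) auto
  then show ?case using Cons by simp
qed simp

lemma big_endian_surj: "v < 2 ^ n \<Longrightarrow> \<exists>s. length s = n \<and> big_endian s = v"
proof (induction n arbitrary: v)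
  case (Suc n)
  have "v - of_bool (2 ^ n \<le> v) * 2 ^ n < 2 ^ n" using Suc.prems by auto
  then obtain s where s: "length s = n" "big_endian s = v - of_bool (2 ^ n \<le> v) * 2 ^ n"
    using Suc.IH by blast
  then have "length ((2 ^ n \<le> v) # s) = Suc n \<and> big_endian ((2 ^ n \<le> v) # s) = v" by auto
  then show ?case by blast
qed simp

lemma computable_big_endian:
  assumes "computable f"
  shows "computable (\<lambda>x. big_endian (str_of_nat (f x)))"
proof -
  have "computable (\<lambda>c. \<Sum>i<length (str_of_nat c).
      of_bool (i < length (str_of_nat c) \<and> str_of_nat c ! i) * 2 ^ (length (str_of_nat c) - Suc i))"
    by (intro comp_intros computable_length dec_nth[unfolded dec_def])
  also have "(\<lambda>c. \<Sum>i<length (str_of_nat c).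
      of_bool (i < length (str_of_nat c) \<and> str_of_nat c ! i) * 2 ^ (length (str_of_nat c) - Suc i))
    = (\<lambda>c. big_endian (str_of_nat c))"
    unfolding big_endian_sum by (intro ext sum.cong) auto
  finally show ?thesis using computable_compose assms by blast
qed

section \<open>Machines given by enumerable graphs\<close>

text \<open>On input \<open>p\<close> the machine searches for output and witness together, coded as
  one number. Single-valuedness makes the output independent of which pair is found first.\<close>

lemma computable_machine_of_graph:
  assumes P: "dec (\<lambda>e. P (fst (prod_decode e)) (fst (prod_decode (snd (prod_decode e))))
      (snd (prod_decode (snd (prod_decode e)))))"
    and single: "\<And>p x t x' t'. P p x t \<Longrightarrow> P p x' t' \<Longrightarrow> x = x'"
  obtains M where "computable_machine M"
    "\<forall>p x. M p = Some x \<longleftrightarrow> (\<exists>t. P (nat_of_str p) (nat_of_str x) t)"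
proof -
  define Q where "Q p e = P p (fst (prod_decode e)) (snd (prod_decode e))" for p e
  let ?S = "\<lambda>p. if \<exists>e. Q p e then Some (LEAST e. Q p e) else None"
  have "partrec ?S"
    by (rule partrec_search) (use P in \<open>simp add: Q_def\<close>)
  from partrec.comp[OF partrec.left this]
  have *: "partrec (\<lambda>p. map_option (\<lambda>e. fst (prod_decode e)) (?S p))"
    by (rule back_subst[of partrec]) auto
  define M where "M p = map_option (\<lambda>e. str_of_nat (fst (prod_decode e))) (?S (nat_of_str p))" for p
  have "computable_machine M"
    unfolding computable_machine_def M_def
    by (rule back_subst[of partrec, OF *]) (auto simp: fun_eq_iff)
  moreover have "M p = Some x \<longleftrightarrow> (\<exists>t. P (nat_of_str p) (nat_of_str x) t)" for p x
  proof
    assume "M p = Some x"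
    then obtain e where "Q (nat_of_str p) e" and x: "x = str_of_nat (fst (prod_decode (LEAST e. Q (nat_of_str p) e)))"
      by (auto simp: M_def split: if_splits)
    from LeastI[of "Q (nat_of_str p)", OF this(1)] x
    show "\<exists>t. P (nat_of_str p) (nat_of_str x) t" by (auto simp: Q_def)
  next
    assume "\<exists>t. P (nat_of_str p) (nat_of_str x) t"
    then obtain t where t: "P (nat_of_str p) (nat_of_str x) t" by blast
    then have ex: "Q (nat_of_str p) (prod_encode (nat_of_str x, t))" by (simp add: Q_def)
    from LeastI[of "Q (nat_of_str p)", OF this] single[OF t]
    have "nat_of_str x = fst (prod_decode (LEAST e. Q (nat_of_str p) e))" by (auto simp: Q_def)
    then have "x = str_of_nat (fst (prod_decode (LEAST e. Q (nat_of_str p) e)))"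
      by (metis str_of_nat_of_str)
    then show "M p = Some x" using ex by (auto simp: M_def)
  qed
  ultimately show ?thesis by (intro that) auto
qed

lemma computable_machine_enumeration:
  assumes "computable_machine M"
  obtains E where "dec (\<lambda>e. E (fst (prod_decode e)) (fst (prod_decode (snd (prod_decode e))))
      (snd (prod_decode (snd (prod_decode e)))))"
    "\<forall>p x. M p = Some x \<longleftrightarrow> (\<exists>t. E (nat_of_str p) (nat_of_str x) t)"
    "\<forall>p x t u. E p x t \<longrightarrow> t \<le> u \<longrightarrow> E p x u"
proof -
  obtain h where h: "computable2 h" "clocks h (\<lambda>n. map_option nat_of_str (M (str_of_nat n)))"
    using partrec_clocked[OF assms[unfolded computable_machine_def]] by blast
  \<comment> \<open>Asking for a report at some earlier stage makes the enumeration monotone in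
    \<open>t\<close>, which \<open>clocks\<close> does not guarantee.\<close>
  define E where "E p x t \<longleftrightarrow> (\<exists>s<t. h p s = Suc x)" for p x t
  show ?thesis
  proof (rule that[of E])
    show "dec (\<lambda>e. E (fst (prod_decode e)) (fst (prod_decode (snd (prod_decode e))))
      (snd (prod_decode (snd (prod_decode e)))))"
      unfolding E_def by (intro comp_intros computable2_apply[OF h(1)])
    show "\<forall>p x. M p = Some x \<longleftrightarrow> (\<exists>t. E (nat_of_str p) (nat_of_str x) t)"
    proof (intro allI iffI)
      fix p x
      assume "M p = Some x"
      then have "\<forall>\<^sub>F t in sequentially. h (nat_of_str p) t = Suc (nat_of_str x)"
        by (intro clocks_complete[OF h(2)]) simp
      then obtain t where "h (nat_of_str p) t = Suc (nat_of_str x)"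
        by (auto simp: eventually_sequentially)
      then show "\<exists>t. E (nat_of_str p) (nat_of_str x) t" unfolding E_def by blast
    next
      fix p x
      assume "\<exists>t. E (nat_of_str p) (nat_of_str x) t"
      then obtain s where "h (nat_of_str p) s = Suc (nat_of_str x)" unfolding E_def by blast
      from clocks_sound[OF h(2) this] show "M p = Some x"
        by (auto dest!: arg_cong[where f = str_of_nat])
    qed
    show "\<forall>p x t u. E p x t \<longrightarrow> t \<le> u \<longrightarrow> E p x u"
      unfolding E_def by (meson less_le_trans)
  qed
qed

section \<open>Measure on Cantor space\<close>

definition cyl :: "bool list \<Rightarrow> (nat \<Rightarrow> bool) set" where
  "cyl s = {A. initial A (length s) = s}"

lemma length_initial[simp]: "length (initial A n) = n"
  by (simp add: initial_def)

lemma nth_initial: "i < n \<Longrightarrow> initial A n ! i = A i"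
  by (simp add: initial_def)

lemma initial_Suc: "initial A (Suc n) = initial A n @ [A n]"
  by (simp add: initial_def)

lemma initial_append: "initial A (n + m) = initial A n @ map A [n..<n + m]"
  using upt_add_eq_append[of 0 n m] by (simp add: initial_def)

lemma initial_eq_iff: "initial A n = initial B n \<longleftrightarrow> (\<forall>i<n. A i = B i)"
  by (auto simp: initial_def)

lemma prefix_initial: "m \<le> n \<Longrightarrow> prefix (initial A m) (initial A n)"
  by (metis initial_append le_add_diff_inverse prefixI)

lemma in_cyl_iff: "A \<in> cyl s \<longleftrightarrow> (\<forall>i<length s. A i = s ! i)"
proof
  assume "A \<in> cyl s"
  then have "initial A (length s) = s" by (simp add: cyl_def)
  then show "\<forall>i<length s. A i = s ! i" by (metis nth_initial)
next
  assume "\<forall>i<length s. A i = s ! i"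
  then show "A \<in> cyl s" unfolding cyl_def by (auto simp: nth_initial intro: nth_equalityI)
qed

lemma cyl_append_subset: "cyl (s @ t) \<subseteq> cyl s"
  by (auto simp: in_cyl_iff nth_append)

lemma cyl_disjoint:
  assumes "\<not> prefix s t" "\<not> prefix t s"
  shows "cyl s \<inter> cyl t = {}"
proof (rule ccontr)
  assume "cyl s \<inter> cyl t \<noteq> {}"
  then obtain A where "initial A (length s) = s" "initial A (length t) = t" by (auto simp: cyl_def)
  then show False using assms prefix_initial[of "length s" "length t" A]
      prefix_initial[of "length t" "length s" A] by (cases "length s \<le> length t") auto
qed

lemma cylinders_eq: "cylinders W = (\<Union>s\<in>W. cyl s)"
  by (auto simp: cylinders_def cyl_def) metis

lemma space_cantor: "space cantor_measure = UNIV"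
  by (simp add: cantor_measure_def space_PiM)

interpretation cantor: prob_space cantor_measure
  unfolding cantor_measure_def by (intro prob_space_PiM prob_space_measure_pmf)

lemma cyl_emb:
  "cyl s = prod_emb UNIV (\<lambda>_. measure_pmf (bernoulli_pmf (1/2))) {..<length s}
    (Pi\<^sub>E {..<length s} (\<lambda>i. {s ! i}))"
  by (intro set_eqI) (simp add: in_cyl_iff prod_emb_def PiE_iff space_PiM Ball_def)

lemma sets_cyl[simp]: "cyl s \<in> sets cantor_measure"
  unfolding cyl_emb cantor_measure_def by (intro sets_PiM_I) auto

lemma sets_cylinders[simp]: "cylinders W \<in> sets cantor_measure"
  unfolding cylinders_eq by (intro sets.countable_UN'') auto

lemma measure_cyl: "measure cantor_measure (cyl s) = (1/2) ^ length s"
proof -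
  interpret product_prob_space "\<lambda>_. measure_pmf (bernoulli_pmf (1/2))" "UNIV :: nat set"
    by (intro product_prob_spaceI prob_space_measure_pmf)
  have "measure cantor_measure (cyl s)
      = (\<Prod>i<length s. measure (measure_pmf (bernoulli_pmf (1/2))) {s ! i})"
    unfolding cyl_emb cantor_measure_def by (intro measure_PiM_emb) auto
  also have "\<dots> = (\<Prod>i<length s. 1/2)"
    by (intro prod.cong) (auto simp: measure_pmf_single)
  finally show ?thesis by simp
qed

lemma measure_UN_cyl:
  assumes "finite X" "\<And>s t. s \<in> X \<Longrightarrow> t \<in> X \<Longrightarrow> prefix s t \<Longrightarrow> s = t"
  shows "measure cantor_measure (\<Union>s\<in>X. cyl s) = (\<Sum>s\<in>X. (1/2) ^ length s)"
proof -
  have "disjoint_family_on cyl X"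
    unfolding disjoint_family_on_def using assms(2) cyl_disjoint by metis
  then show ?thesis
    using cantor.finite_measure_finite_Union[OF assms(1), of cyl] by (simp add: measure_cyl image_subset_iff)
qed

lemma measure_UN_cyl_same_length:
  assumes "finite X" "\<And>s. s \<in> X \<Longrightarrow> length s = n"
  shows "measure cantor_measure (\<Union>s\<in>X. cyl s) = real (card X) * (1/2) ^ n"
proof -
  have "measure cantor_measure (\<Union>s\<in>X. cyl s) = (\<Sum>s\<in>X. (1/2) ^ length s)"
    by (rule measure_UN_cyl[OF assms(1)]) (metis assms(2) append_eq_conv_conj prefix_def take_all_iff order_refl)
  then show ?thesis by (simp add: assms(2))
qed

lemma Kraft_inequality:
  assumes "prefix_free M" "finite F" "F \<subseteq> dom M"
  shows "(\<Sum>p\<in>F. (1/2) ^ length p) \<le> (1::real)"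
proof -
  have "(\<Sum>p\<in>F. (1/2) ^ length p) = measure cantor_measure (\<Union>s\<in>F. cyl s)"
    using assms unfolding prefix_free_def by (intro measure_UN_cyl[symmetric]) blast+
  also have "\<dots> \<le> 1" by (rule cantor.prob_le_1)
  finally show ?thesis .
qed

lemma finite_strings: "finite {s :: bool list. length s = n}"
  using finite_lists_length_eq[of "UNIV :: bool set" n] by simp

section \<open>Existence of random sequences\<close>

text \<open>Syntax for the clauses of \<open>partrec\<close>. It shows that there are countably many
  partial recursive functions, hence countably many enumerable sets and Martin-Loef tests.\<close>

datatype code = Zero | Succ | Left | Right | Pair code code | Comp code code | Prec code code | Search code

instance code :: countable
  by countable_datatype

primrec meaning :: "code \<Rightarrow> nat \<rightharpoonup> nat" where
  "meaning Zero = (\<lambda>_. Some 0)"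
| "meaning Succ = (\<lambda>n. Some (Suc n))"
| "meaning Left = (\<lambda>n. Some (fst (prod_decode n)))"
| "meaning Right = (\<lambda>n. Some (snd (prod_decode n)))"
| "meaning (Pair p q) = (\<lambda>n. Option.bind (meaning p n) (\<lambda>a. Option.bind (meaning q n) (\<lambda>b. Some (prod_encode (a, b)))))"
| "meaning (Comp p q) = (\<lambda>n. Option.bind (meaning q n) (meaning p))"
| "meaning (Prec p q) = (\<lambda>n. iterate (meaning p) (meaning q) (fst (prod_decode n)) (snd (prod_decode n)))"
| "meaning (Search p) = (\<lambda>a. minimize (\<lambda>n. meaning p (prod_encode (a, n))))"

lemma partrec_meaning: "partrec g \<Longrightarrow> g \<in> range meaning"
proof (induction rule: partrec.induct)
  case zero show ?case by (rule range_eqI[of _ _ Zero]) simp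
next
  case succ show ?case by (rule range_eqI[of _ _ Succ]) simp
next
  case left show ?case by (rule range_eqI[of _ _ Left]) simp
next
  case right show ?case by (rule range_eqI[of _ _ Right]) simp
next
  case (pair f g)
  then obtain p q where "f = meaning p" "g = meaning q" by blast
  then show ?case by (intro range_eqI[of _ _ "Pair p q"]) simp
next
  case (comp f g)
  then obtain p q where "f = meaning p" "g = meaning q" by blast
  then show ?case by (intro range_eqI[of _ _ "Comp p q"]) simp
next
  case (prec f g)
  then obtain p q where "f = meaning p" "g = meaning q" by blast
  then show ?case by (intro range_eqI[of _ _ "Prec p q"]) simp
next
  case (search f)
  then obtain p where "f = meaning p" by blast
  then show ?case by (intro range_eqI[of _ _ "Search p"]) simp
qed

lemma countable_ce: "countable {S. ce S}"
proof -
  have "{S. ce S} \<subseteq> (\<lambda>p. dom (meaning p)) ` UNIV"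
    using partrec_meaning unfolding ce_def by fastforce
  then show ?thesis by (rule countable_subset) simp
qed

lemma countable_ml_test: "countable {W. ml_test W}"
proof (rule countable_image_inj_on)
  let ?g = "\<lambda>W. {prod_encode (n, nat_of_str s) | n s. s \<in> W n}"
  show "countable (?g ` {W. ml_test W})"
    by (rule countable_subset[OF _ countable_ce]) (auto simp: ml_test_def)
  have inj: "W = W'" if "?g W = ?g W'" for W W'
  proof (intro ext set_eqI)
    fix n s
    have "s \<in> W n \<longleftrightarrow> prod_encode (n, nat_of_str s) \<in> ?g W" for W
      using bij_is_inj[OF bij_nat_of_str] by (auto dest: injD)
    then show "s \<in> W n \<longleftrightarrow> s \<in> W' n" using that by blast
  qed
  show "inj_on ?g {W. ml_test W}" by (rule inj_onI) (rule inj)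
qed

lemma ml_test_null:
  assumes "ml_test W"
  shows "(\<Inter>n. cylinders (W n)) \<in> null_sets cantor_measure"
proof (rule null_setsI)
  have "measure cantor_measure (\<Inter>n. cylinders (W n)) \<le> (1/2) ^ n" for n
  proof -
    have "measure cantor_measure (\<Inter>n. cylinders (W n)) \<le> measure cantor_measure (cylinders (W n))"
      by (intro cantor.finite_measure_mono) auto
    also have "\<dots> \<le> (1/2) ^ n" using assms by (simp add: ml_test_def)
    finally show ?thesis .
  qed
  then have "measure cantor_measure (\<Inter>n. cylinders (W n)) \<le> 0"
    by (intro LIMSEQ_le_const[of "\<lambda>n. (1/2) ^ n"] LIMSEQ_power_zero) auto
  then show "emeasure cantor_measure (\<Inter>n. cylinders (W n)) = 0"
    by (simp add: cantor.emeasure_eq_measure measure_le_0_iff)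
qed auto

text \<open>Countably many null sets cannot cover a space of measure 1.\<close>

lemma ml_random_exists: "\<exists>A. ml_random A"
proof (rule ccontr)
  assume "\<nexists>A. ml_random A"
  then have "UNIV \<subseteq> (\<Union>W\<in>{W. ml_test W}. \<Inter>n. cylinders (W n))"
    unfolding ml_random_def by blast
  moreover have "(\<Union>W\<in>{W. ml_test W}. \<Inter>n. cylinders (W n)) \<in> null_sets cantor_measure"
    by (intro null_sets_UN' countable_ml_test) (simp add: ml_test_null)
  ultimately have "space cantor_measure \<in> null_sets cantor_measure"
    by (simp add: space_cantor top.extremum_unique)
  then show False using cantor.emeasure_space_1 by auto
qed

section \<open>Complexity\<close>

lemma complexity_le: "U p = Some x \<Longrightarrow> complexity U x \<le> length p"
  unfolding complexity_def by (rule Least_le) blast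

lemma complexity_witness:
  assumes "\<exists>p. U p = Some x"
  obtains p where "U p = Some x" "length p = complexity U x"
  using LeastI_ex[of "\<lambda>k. \<exists>p. length p = k \<and> U p = Some x"] assms
  unfolding complexity_def by blast

lemma simulates_complexity:
  assumes "simulates U M"
  obtains c where "\<And>p x. M p = Some x \<Longrightarrow> complexity U x \<le> length p + c"
  using assms complexity_le unfolding simulates_def by (metis order_trans)

lemma card_low_complexity:
  assumes "\<And>x. \<exists>p. U p = Some x"
  shows "finite {x. complexity U x < m} \<and> card {x. complexity U x < m} < 2 ^ m"
proof -
  let ?P = "{p :: bool list. length p < m}"
  have card: "finite {p :: bool list. length p < k} \<and> card {p :: bool list. length p < k} < 2 ^ k" for k
  proof (induction k)
    case (Suc k)
    have "{p :: bool list. length p < Suc k} = {p. length p < k} \<union> {p. length p = k}" by auto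
    moreover have "card {p :: bool list. length p = k} = 2 ^ k"
      using card_lists_length_eq[of "UNIV :: bool set" k] by simp
    ultimately show ?case
      using Suc finite_strings[of k] card_Un_le[of "{p :: bool list. length p < k}" "{p. length p = k}"]
      by simp
  qed simp
  have "{x. complexity U x < m} \<subseteq> (\<lambda>p. the (U p)) ` ?P"
  proof
    fix x assume "x \<in> {x. complexity U x < m}"
    moreover obtain p where "U p = Some x" "length p = complexity U x"
      using complexity_witness[of U x] assms by blast
    ultimately show "x \<in> (\<lambda>p. the (U p)) ` ?P" by (intro image_eqI[of _ _ p]) auto
  qed
  then show ?thesis
    using card[of m] by (meson card_image_le card_mono finite_imageI finite_subset le_less_trans)
qed

section \<open>Right-c.e. functions with a divergent sum\<close>

lemma right_ce_approximation:
  assumes "right_ce f"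
  obtains h where "computable2 h" "\<And>n s t. s \<le> t \<Longrightarrow> h n t \<le> h n s" "\<And>n t. f n \<le> h n t"
    "\<And>n. \<exists>t0. \<forall>t\<ge>t0. h n t = f n"
proof -
  obtain h where h: "computable2 h" "\<And>n. antimono (h n)" "\<And>n. (\<lambda>t. h n t) \<longlonglongrightarrow> f n"
    using assms unfolding right_ce_def by blast
  have lim: "\<exists>t0. \<forall>t\<ge>t0. h n t = f n" for n
    using h(3)[of n] by (simp add: tendsto_discrete eventually_sequentially)
  moreover have mono: "h n t \<le> h n s" if "s \<le> t" for n s t using h(2) that by (rule antimonoD)
  moreover have "f n \<le> h n t" for n t
  proof -
    obtain t0 where "\<forall>t\<ge>t0. h n t = f n" using lim by blast
    then have "h n (max t t0) = f n" by simp
    with mono[of t "max t t0" n] show ?thesis by simp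
  qed
  ultimately show ?thesis using h(1) by (intro that)
qed

lemma finitely_many_settled:
  assumes "\<And>n. \<exists>t0. \<forall>t\<ge>t0. P n t"
  shows "\<exists>t0::nat. \<forall>t\<ge>t0. \<forall>n<(N::nat). P n t"
proof -
  have "\<forall>\<^sub>F t in sequentially. \<forall>n\<in>{..<N}. P n t"
    by (rule eventually_ball_finite) (use assms in \<open>auto simp: eventually_sequentially\<close>)
  then show ?thesis by (simp add: eventually_sequentially Ball_def)
qed

lemma nonsummable_sum_large:
  fixes r :: "nat \<Rightarrow> real"
  assumes "\<not> summable r" "\<And>n. 0 \<le> r n"
  shows "\<exists>n. K < (\<Sum>i<n. r i)"
  using summableI_nonneg_bounded[of r K] assms by (metis not_le)

text \<open>By divergence one can search for consecutive blocks of which the \<open>k\<close>-th has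
  weight at least \<open>2^k\<close> already at a finite stage. Raising the exponents on it by
  \<open>k\<close> leaves weight at least 1 per block. The stage of the block replaces the limit,
  which makes \<open>g\<close> computable.\<close>

lemma computable_minorant_divergent:
  assumes "right_ce f" "\<not> summable (\<lambda>n. (1/2 :: real) ^ f n)"
  obtains g where "computable g" "\<not> summable (\<lambda>n. (1/2 :: real) ^ g n)"
    "\<And>c. \<exists>N. \<forall>n\<ge>N. f n + c \<le> g n"
proof -
  obtain h where h: "computable2 h" "\<And>n s t. s \<le> t \<Longrightarrow> h n t \<le> h n s" "\<And>n t. f n \<le> h n t"
    "\<And>n. \<exists>t0. \<forall>t\<ge>t0. h n t = f n"
    using right_ce_approximation[OF assms(1)] by blast
  \<comment> \<open>\<open>t\<close> is both the end of the block starting at \<open>m\<close> and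
    the stage at which \<open>h\<close> is read; \<open>m < t\<close> makes the block ends strictly
    increasing.\<close>
  define Q where "Q k m t \<longleftrightarrow> m < t \<and> real (2 ^ k) \<le> (\<Sum>i<t. if m \<le> i then (1/2) ^ h i t else 0)" for k m t
  have exQ: "\<exists>t. Q k m t" for k m
  proof -
    obtain u where u: "(\<Sum>i<m. (1/2 :: real) ^ f i) + real (2 ^ k) < (\<Sum>i<u. (1/2) ^ f i)"
      using nonsummable_sum_large[OF assms(2)] by auto
    obtain t0 where t0: "\<forall>t\<ge>t0. \<forall>n<u. h n t = f n"
      using finitely_many_settled[of "\<lambda>n t. h n t = f n", OF h(4)] by blast
    define t where "t = max (max t0 u) (Suc m)"
    have "(\<Sum>i<u. (1/2 :: real) ^ f i) \<le> (\<Sum>i<u. (if m \<le> i then (1/2) ^ f i else 0) + (if i < m then (1/2) ^ f i else 0))"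
      by (intro sum_mono) auto
    also have "\<dots> = (\<Sum>i<u. if m \<le> i then (1/2) ^ f i else 0) + (\<Sum>i<u. if i < m then (1/2) ^ f i else 0)"
      by (rule sum.distrib)
    also have "(\<Sum>i<u. if i < m then (1/2 :: real) ^ f i else 0) = (\<Sum>i\<in>{..<u} \<inter> {..<m}. (1/2) ^ f i)"
      by (subst sum.inter_restrict) (auto intro: sum.cong)
    also have "\<dots> \<le> (\<Sum>i<m. (1/2) ^ f i)" by (intro sum_mono2) auto
    also have "(\<Sum>i<u. if m \<le> i then (1/2 :: real) ^ f i else 0) = (\<Sum>i<u. if m \<le> i then (1/2) ^ h i t else 0)"
      using t0 by (intro sum.cong) (auto simp: t_def)
    also have "\<dots> \<le> (\<Sum>i<t. if m \<le> i then (1/2) ^ h i t else 0)"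
      by (intro sum_mono2) (auto simp: t_def)
    finally have "real (2 ^ k) \<le> (\<Sum>i<t. if m \<le> i then (1/2) ^ h i t else 0)" using u by linarith
    moreover have "m < t" by (simp add: t_def)
    ultimately have "Q k m t" by (simp add: Q_def)
    then show ?thesis by blast
  qed
  define T where "T k m = (LEAST t. Q k m t)" for k m
  have T: "Q k m (T k m)" for k m unfolding T_def using exQ by (rule LeastI_ex)
  define z where "z = rec_nat 0 T"
  have z0: "z 0 = 0" and zS: "z (Suc k) = T k (z k)" for k by (simp_all add: z_def)
  have zless: "z k < z (Suc k)" for k using T[of k "z k"] by (simp add: zS Q_def)
  have zmono: "strict_mono z" using zless by (simp add: strict_mono_Suc_iff)
  define K where "K n = (LEAST k. n < z (Suc k))" for n
  have exK: "\<exists>k. n < z (Suc k)" for n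
    using strict_mono_imp_increasing[OF zmono, of "Suc n"] by (intro exI[of _ n]) simp
  have K: "K n = k" if "z k \<le> n" "n < z (Suc k)" for n k
    unfolding K_def using that(2)
  proof (rule Least_equality)
    fix j assume "n < z (Suc j)"
    then have "z k < z (Suc j)" using that(1) by simp
    then show "k \<le> j" using zmono by (simp add: strict_mono_less)
  qed
  have "computable2 (\<lambda>k m. T k m)"
    unfolding T_def
  proof (rule computable2I, rule computable_Least)
    show "\<exists>n. Q (fst (prod_decode e)) (snd (prod_decode e)) n" for e by (rule exQ)
    show "dec (\<lambda>e. Q (fst (prod_decode (fst (prod_decode e)))) (snd (prod_decode (fst (prod_decode e))))
        (snd (prod_decode e)))"
      unfolding Q_def by (intro comp_intros computable2_apply[OF h(1)] rat_of_nat[of "\<lambda>_. 0", simplified])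
  qed
  note T_comp = this
  have z_comp: "computable z"
    unfolding z_def by (intro computable_rec[of "\<lambda>_. 0" "\<lambda>_. T" "\<lambda>x. x"] comp_intros computable2_apply[OF T_comp])
  have K_comp: "computable K"
    unfolding K_def
    by (rule computable_Least[OF _ exK]) (intro comp_intros computable_compose[OF z_comp])
  define g where "g n = h n (z (Suc (K n))) + K n" for n
  have "computable g"
    unfolding g_def by (intro comp_intros computable2_apply[OF h(1)] computable_compose[OF z_comp] K_comp)
  moreover have "\<not> summable (\<lambda>n. (1/2 :: real) ^ g n)"
  proof
    assume sm: "summable (\<lambda>n. (1/2 :: real) ^ g n)"
    have "real k \<le> (\<Sum>n<z k. (1/2) ^ g n)" for k
    proof (induction k)
      case (Suc k)
      have "1 \<le> (1/2) ^ k * (\<Sum>i<z (Suc k). if z k \<le> i then (1/2 :: real) ^ h i (z (Suc k)) else 0)"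
        using T[of k "z k", folded zS] by (simp add: Q_def field_simps)
      also have "\<dots> = (\<Sum>i<z (Suc k). if z k \<le> i then (1/2 :: real) ^ g i else 0)"
        unfolding sum_distrib_left by (intro sum.cong) (auto simp: g_def K power_add)
      also have "\<dots> = (\<Sum>i\<in>{..<z (Suc k)} \<inter> {z k..}. (1/2 :: real) ^ g i)"
        by (subst sum.inter_restrict) (auto intro: sum.cong)
      also have "{..<z (Suc k)} \<inter> {z k..} = {z k..<z (Suc k)}" by auto
      finally have "1 \<le> (\<Sum>i\<in>{z k..<z (Suc k)}. (1/2 :: real) ^ g i)" .
      moreover have "(\<Sum>n<z (Suc k). (1/2 :: real) ^ g n) = (\<Sum>n<z k. (1/2) ^ g n) + (\<Sum>i\<in>{z k..<z (Suc k)}. (1/2) ^ g i)"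
        using sum.atLeastLessThan_concat[of 0 "z k" "z (Suc k)" "\<lambda>n. (1/2 :: real) ^ g n"] zless[of k]
        by (simp add: atLeast0LessThan)
      ultimately show ?case using Suc by simp
    qed (simp add: z0)
    moreover have "(\<Sum>n<z k. (1/2 :: real) ^ g n) \<le> suminf (\<lambda>n. (1/2) ^ g n)" for k
      by (rule sum_le_suminf[OF sm]) auto
    ultimately have "real k \<le> suminf (\<lambda>n. (1/2) ^ g n)" for k by (meson order_trans)
    then show False by (meson not_le reals_Archimedean2)
  qed
  moreover have "\<exists>N. \<forall>n\<ge>N. f n + c \<le> g n" for c
  proof (intro exI allI impI)
    fix n assume n: "z c \<le> n"
    have "n < z (Suc (K n))" unfolding K_def using exK by (rule LeastI_ex)
    with n have "z c < z (Suc (K n))" by simp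
    then have "c \<le> K n" using zmono by (simp add: strict_mono_less)
    then show "f n + c \<le> g n" using h(3)[of n] by (simp add: g_def add_mono)
  qed
  ultimately show ?thesis by (rule that)
qed

text \<open>
  Intervals of length \<open>2^-g(n)\<close> laid out consecutively around the circle cover every point infinitely
  often, and a point in the \<open>n\<close>-th interval has its first \<open>n\<close> bits described by \<open>n - g n\<close> bits,
  provided \<open>n\<close> can be recovered from \<open>n - g n\<close>. This is ensured by using only those \<open>n\<close> at which
  \<open>n - g n\<close> takes a new record value, which keeps the sum divergent.
\<close>

lemma machine_covering_circle:
  assumes g: "computable g" "\<not> summable (\<lambda>n. (1/2 :: real) ^ g n)"
  obtains M where "computable_machine M"
    "\<And>A N. \<exists>n\<ge>N. g n \<le> n \<and> (\<exists>p. length p = n - g n \<and> M p = Some (initial A n))"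
proof -
  define R where "R = rec_nat 0 (\<lambda>n r. max r (n - g n))"
  have R0: "R 0 = 0" and RS: "R (Suc n) = max (R n) (n - g n)" for n by (simp_all add: R_def)
  have R_comp: "computable R"
    unfolding R_def
    by (intro computable_rec[of "\<lambda>_. 0" "\<lambda>_ n r. max r (n - g n)" "\<lambda>x. x"] comp_intros computable_compose[OF g(1)])
  \<comment> \<open>Subtraction is truncated, but a new record is positive and so forces
    \<open>g n < n\<close>.\<close>
  define S where "S n \<longleftrightarrow> R n < n - g n" for n
  have S_comp: "dec (\<lambda>x. S (k x))" if "computable k" for k
    unfolding S_def by (intro comp_intros computable_compose[OF R_comp] computable_compose[OF g(1)] that)
  define w where "w n = (if S n then 2 ^ (n - g n) else 0 :: nat)" for n
  \<comment> \<open>\<open>b n / 2 ^ n\<close> is the left end of the \<open>n\<close>-th interval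
    before reduction modulo 1, that is, the total length of the selected intervals so far. The
    doubling passes from the unit \<open>2^-n\<close> to \<open>2^-(n+1)\<close>.\<close>
  define b where "b = rec_nat 0 (\<lambda>n r. 2 * (r + w n))"
  have b0: "b 0 = 0" and bS: "b (Suc n) = 2 * (b n + w n)" for n by (simp_all add: b_def)
  have b_comp: "computable b"
    unfolding b_def w_def
    by (intro computable_rec[of "\<lambda>_. 0" "\<lambda>_ n r. 2 * (r + (if S n then 2 ^ (n - g n) else 0))" "\<lambda>x. x"]
        comp_intros computable_compose[OF g(1)] S_comp)
  have R_ge: "m - g m \<le> R n" if "m < n" for m n
    using that by (induction n) (auto simp: RS less_Suc_eq)
  have S_inj: "n = n'" if "S n" "S n'" "n - g n = n' - g n'" for n n'
    using that R_ge[of n n'] R_ge[of n' n] unfolding S_def by (cases n n' rule: linorder_cases) auto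
  \<comment> \<open>\<open>p\<close> is the offset inside the \<open>n\<close>-th interval in units
    of \<open>2^-n\<close>; the reduction modulo \<open>2 ^ n\<close> wraps around the
    circle.\<close>
  define P where "P p x n \<longleftrightarrow> S n \<and> length (str_of_nat p) = n - g n \<and> length (str_of_nat x) = n \<and>
    big_endian (str_of_nat x) = (b n + big_endian (str_of_nat p)) mod 2 ^ n" for p x n
  have single: "x = x'" if "P p x n" "P p x' n'" for p x n x' n'
  proof -
    have "n = n'" using that S_inj by (simp add: P_def)
    then have "str_of_nat x = str_of_nat x'"
      using that by (intro big_endian_inj) (simp_all add: P_def)
    then show ?thesis by (metis nat_of_str_of_nat)
  qed
  have "dec (\<lambda>e. P (fst (prod_decode e)) (fst (prod_decode (snd (prod_decode e))))
      (snd (prod_decode (snd (prod_decode e)))))"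
    unfolding P_def by (intro comp_intros S_comp computable_length computable_big_endian
        computable_compose[OF b_comp] computable_compose[OF g(1)])
  then obtain M where M0: "computable_machine M"
    "\<forall>p x. M p = Some x \<longleftrightarrow> (\<exists>n. P (nat_of_str p) (nat_of_str x) n)"
    using single by (rule computable_machine_of_graph)
  note M = M0(1) M0(2)[rule_format]

  \<comment> \<open>A rejected \<open>n\<close> has \<open>2^-g(n) \<le> 2^(R n - n)\<close>. While
    \<open>R\<close> is constant this bound halves at each step, so \<open>2 * 2^(R n - n)\<close>
    is credit for all rejections up to the next record. A record adds \<open>2^-g(n)\<close> to the
    sum and needs new credit of the same size, whence the factor 2 before the total selected
    length.\<close>
  have potential: "(\<Sum>m<n. (1/2 :: real) ^ g m) + 2 * (2 ^ R n / 2 ^ n) \<le> 2 + 2 * (real (b n) / 2 ^ n)" for n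
  proof (induction n)
    case (Suc n)
    show ?case
    proof (cases "S n")
      case True
      then have gn: "g n \<le> n" "R (Suc n) = n - g n" by (auto simp: S_def RS)
      then have "(2::real) ^ (n - g n) = 2 ^ n * (1/2) ^ g n"
        by (simp add: power_diff power_one_over)
      then have "2 * (2 ^ R (Suc n) / 2 ^ Suc n :: real) = (1/2) ^ g n"
        and "2 * (real (b (Suc n)) / 2 ^ Suc n) = 2 * (real (b n) / 2 ^ n) + 2 * (1/2) ^ g n"
        using True gn by (simp_all add: bS w_def field_simps)
      moreover have "0 \<le> 2 * (2 ^ R n / 2 ^ n :: real)" by simp
      ultimately show ?thesis using Suc unfolding sum.lessThan_Suc by linarith
    next
      case False
      then have R: "n - g n \<le> R n" "R (Suc n) = R n" by (auto simp: S_def RS)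
      have "(1/2 :: real) ^ g n \<le> 2 ^ R n / 2 ^ n"
      proof -
        have "(2::real) ^ n \<le> 2 ^ (R n + g n)" using R by (intro power_increasing) auto
        then show ?thesis by (simp add: power_add power_one_over field_simps)
      qed
      moreover have "2 * (2 ^ R (Suc n) / 2 ^ Suc n :: real) = 2 ^ R n / 2 ^ n"
        and "2 * (real (b (Suc n)) / 2 ^ Suc n) = 2 * (real (b n) / 2 ^ n)"
        using False R by (simp_all add: bS w_def)
      ultimately show ?thesis using Suc unfolding sum.lessThan_Suc by linarith
    qed
  qed (simp add: R0 b0)

  have "\<exists>n\<ge>N. g n \<le> n \<and> (\<exists>p. length p = n - g n \<and> M p = Some (initial A n))" for A N
  proof -
    \<comment> \<open>The point \<open>A\<close> is moved to the \<open>k\<close>-th turn around the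
      circle, beyond the right ends of all intervals before \<open>N\<close>. \<open>x n\<close> is
      this point in units of \<open>2^-n\<close>, rounded down.\<close>
    define k where "k = (\<Sum>m<N. b m + w m)"
    define x where "x n = k * 2 ^ n + big_endian (initial A n)" for n
    have xS: "2 * x n \<le> x (Suc n)" for n
      by (simp add: x_def initial_Suc big_endian_append algebra_simps)
    obtain n where "2 + 2 * (real k + 1) < (\<Sum>m<n. (1/2 :: real) ^ g m)"
      using nonsummable_sum_large[OF g(2)] by auto
    moreover have "a + 1 < y" if "2 + 2 * (a + 1) < s" "0 \<le> u" "s + 2 * u \<le> 2 + 2 * y" for a s u y :: real
      using that by simp
    ultimately have "real k + 1 < real (b n) / 2 ^ n" using potential[of n] by (meson zero_le_divide_iff zero_le_numeral zero_le_power)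
    then have "real ((k + 1) * 2 ^ n) < real (b n)" by (simp add: field_simps)
    then have "(k + 1) * 2 ^ n < b n" by (simp only: of_nat_less_iff)
    then have "x n < b n" using big_endian_less[of "initial A n"] by (simp add: x_def algebra_simps)
    \<comment> \<open>At \<open>m'\<close> the left end has passed the point for the first time, so
      the interval just before it contains the point.\<close>
    define m' where "m' = (LEAST n. x n < b n)"
    have m': "x m' < b m'" unfolding m'_def using \<open>x n < b n\<close> by (rule LeastI)
    then obtain m where m: "m' = Suc m" by (cases m') (auto simp: b0)
    then have le: "b m \<le> x m" using not_less_Least[of m "\<lambda>n. x n < b n"] unfolding m'_def by simp
    have less: "x m < b m + w m" using le_less_trans[OF xS[of m] m'[unfolded m bS]] by simp
    have S: "S m" using le less by (auto simp: w_def split: if_splits)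
    then have gm: "g m \<le> m" by (auto simp: S_def)
    have "x m - b m < 2 ^ (m - g m)" using le less S by (simp add: w_def)
    then obtain p where p: "length p = m - g m" "big_endian p = x m - b m"
      using big_endian_surj by blast
    have "x m mod 2 ^ m = big_endian (initial A m)"
      using big_endian_less[of "initial A m"] by (simp add: x_def)
    then have "P (nat_of_str p) (nat_of_str (initial A m)) m"
      using S p le by (simp add: P_def)
    then have "M p = Some (initial A m)" using M(2) by blast
    moreover have "N \<le> m"
    proof (rule ccontr)
      assume "\<not> N \<le> m"
      then have "b m + w m \<le> k" unfolding k_def by (intro member_le_sum) auto
      also have "k \<le> k * 2 ^ m" by simp
      also have "\<dots> \<le> x m" by (simp add: x_def)
      finally show False using less by simp
    qed
    ultimately show ?thesis using gm p(1) by blast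
  qed
  with M(1) show ?thesis by (rule that)
qed

lemma low_complexity_if_divergent:
  assumes "optimal_plain U" "right_ce f" "\<not> summable (\<lambda>n. (1/2 :: real) ^ f n)"
  shows "\<exists>n. int (complexity U (initial A n)) < int n - int (f n) - c"
proof -
  obtain g where g: "computable g" "\<not> summable (\<lambda>n. (1/2 :: real) ^ g n)"
    "\<And>c. \<exists>N. \<forall>n\<ge>N. f n + c \<le> g n"
    using computable_minorant_divergent[OF assms(2,3)] by blast
  obtain M where M: "computable_machine M"
    "\<And>A N. \<exists>n\<ge>N. g n \<le> n \<and> (\<exists>p. length p = n - g n \<and> M p = Some (initial A n))"
    using machine_covering_circle[OF g(1,2)] by blast
  then have "simulates U M" using assms(1) by (simp add: optimal_plain_def)
  then obtain d where d: "\<And>p x. M p = Some x \<Longrightarrow> complexity U x \<le> length p + d"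
    using simulates_complexity by blast
  \<comment> \<open>\<open>d\<close> pays for the simulation of \<open>M\<close> by
    \<open>U\<close>, and the extra 1 makes the inequality strict.\<close>
  obtain N where N: "\<forall>n\<ge>N. f n + (d + nat (c + 1)) \<le> g n" using g(3) by blast
  obtain n p where np: "N \<le> n" "g n \<le> n" "length p = n - g n" "M p = Some (initial A n)"
    using M(2)[of N A] by blast
  from d[OF np(4)] N np have "int (complexity U (initial A n)) < int n - int (f n) - c"
    by (auto simp: of_nat_diff)
  then show ?thesis by blast
qed

section \<open>Upper bounds for prefix-free complexity\<close>

definition dyadic :: "bool list \<Rightarrow> real" where
  "dyadic s = real (big_endian s) * (1/2) ^ length s"

lemma dyadic_prefix:
  assumes "prefix p q"
  shows "dyadic p \<le> dyadic q \<and> dyadic q + (1/2) ^ length q \<le> dyadic p + (1/2) ^ length p"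
proof -
  obtain r where q: "q = p @ r" using assms by (auto simp: prefix_def)
  have "dyadic q = dyadic p + (1/2) ^ length p * (real (big_endian r) * (1/2) ^ length r)"
    by (simp add: dyadic_def q big_endian_append power_add field_simps)
  moreover have "0 \<le> (1/2) ^ length p * (real (big_endian r) * (1/2) ^ length r)" by simp
  moreover have "(1/2) ^ length q = (1/2 :: real) ^ length p * (1/2) ^ length r"
    by (simp add: q power_add)
  moreover have "real (big_endian r) + 1 \<le> 2 ^ length r"
    using big_endian_less[of r] by (metis Suc_leI of_nat_Suc of_nat_le_iff of_nat_numeral of_nat_power add.commute)
  then have "(1/2) ^ length p * ((real (big_endian r) + 1) * (1/2) ^ length r) \<le> (1/2 :: real) ^ length p * 1"
    by (intro mult_left_mono) (auto simp: field_simps)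
  ultimately show ?thesis by (simp add: algebra_simps)
qed

text \<open>The values that occur are strictly decreasing, so their powers at least double each time
  and the sum is at most twice the last one.\<close>

lemma sum_of_new_values:
  fixes h :: "nat \<Rightarrow> nat"
  assumes "\<And>s t. s \<le> t \<Longrightarrow> h t \<le> h s" "\<And>t. m \<le> h t"
  shows "(\<Sum>t<T. if t = 0 \<or> h t < h (t - 1) then (1/2) ^ h t else 0) \<le> (2 * (1/2) ^ m :: real)"
proof -
  let ?r = "\<lambda>t. if t = 0 \<or> h t < h (t - 1) then (1/2) ^ h t else 0 :: real"
  have "(\<Sum>t<Suc T. ?r t) \<le> 2 * (1/2) ^ h T"
  proof (induction T)
    case (Suc T)
    show ?case
    proof (cases "h (Suc T) < h T")
      case True
      then have "(1/2 :: real) ^ h T \<le> (1/2) ^ Suc (h (Suc T))" by (intro power_decreasing) auto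
      then show ?thesis using Suc True by simp
    next
      case False
      then have "h (Suc T) = h T" using assms(1)[of T "Suc T"] by simp
      then show ?thesis using Suc False by simp
    qed
  qed simp
  also have "2 * (1/2) ^ h T \<le> (2 * (1/2) ^ m :: real)"
    using assms(2)[of T] by (intro mult_left_mono power_decreasing) auto
  finally have "(\<Sum>t<Suc T. ?r t) \<le> 2 * (1/2) ^ m" .
  moreover have "(\<Sum>t<T. ?r t) \<le> (\<Sum>t<Suc T. ?r t)" by simp
  ultimately show ?thesis by linarith
qed

text \<open>
  The Kraft-Chaitin construction. Request \<open>i\<close> owns an interval of length \<open>2 * 2^-L\<close> placed right after
  those of the earlier requests; such an interval always contains an aligned dyadic one of length
  \<open>2^-L\<close>, which is the code word.
\<close>

lemma complexity_le_if_summable: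
  assumes V: "optimal_prefix_free V" and "right_ce f" and sm: "summable (\<lambda>n. (1/2 :: real) ^ f n)"
  shows "\<exists>c. \<forall>n. complexity_nat V n \<le> f n + c"
proof -
  obtain h where h: "computable2 h" "\<And>n s t. s \<le> t \<Longrightarrow> h n t \<le> h n s" "\<And>n t. f n \<le> h n t"
    "\<And>n. \<exists>t0. \<forall>t\<ge>t0. h n t = f n"
    using right_ce_approximation[OF assms(2)] by blast
  obtain c where c: "suminf (\<lambda>n. (1/2 :: real) ^ f n) \<le> 2 ^ c"
    by (meson less_imp_le real_arch_pow one_less_numeral_iff semiring_norm(76))
  define act where "act n t \<longleftrightarrow> t = 0 \<or> h n t < h n (t - 1)" for n t
  \<comment> \<open>The constant 2 pays for two doublings: the requests for superseded values of
    \<open>h n\<close>, and the interval that is twice as long as its code word requires.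
    \<open>2 ^ c\<close> bounds the sum itself.\<close>
  define L where "L n t = h n t + c + 2" for n t
  define W where "W n t = (if act n t then 2 * (1/2) ^ L n t else 0 :: real)" for n t
  define pos where "pos i = (\<Sum>k<i. W (fst (prod_decode k)) (snd (prod_decode k)))" for i
  have W_nonneg: "0 \<le> W n t" for n t by (simp add: W_def)
  have pos_le_1: "pos i \<le> 1" for i
  proof -
    \<comment> \<open>A pair has components no larger than its code, so the requests before
      \<open>i\<close> lie in a square and can be summed row by row.\<close>
    have sub: "prod_decode ` {..<i} \<subseteq> {..<i} \<times> {..<i}"
    proof
      fix y assume "y \<in> prod_decode ` {..<i}"
      then obtain k where k: "k < i" "y = prod_decode k" by blast
      then have "prod_encode (fst y, snd y) < i" by simp
      then show "y \<in> {..<i} \<times> {..<i}"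
        using le_prod_encode_1[of "fst y" "snd y"] le_prod_encode_2[of "snd y" "fst y"]
        by (cases y) auto
    qed
    have "pos i = (\<Sum>(n, t)\<in>prod_decode ` {..<i}. W n t)"
      unfolding pos_def by (subst sum.reindex) (auto intro: inj_on_subset[OF inj_prod_decode] simp: case_prod_beta)
    also have "\<dots> \<le> (\<Sum>(n, t)\<in>{..<i} \<times> {..<i}. W n t)"
      by (rule sum_mono2[OF _ sub]) (auto simp: W_nonneg)
    also have "\<dots> = (\<Sum>n<i. \<Sum>t<i. W n t)" by (rule sum.cartesian_product[symmetric])
    also have "\<dots> \<le> (\<Sum>n<i. (1/2) ^ c * (1/2) ^ f n)"
    proof (rule sum_mono)
      fix n
      have "(\<Sum>t<i. W n t) = (1/2) ^ Suc c * (\<Sum>t<i. if t = 0 \<or> h n t < h n (t - 1) then (1/2) ^ h n t else 0)"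
        unfolding sum_distrib_left W_def act_def L_def by (intro sum.cong) (auto simp: power_add)
      also have "\<dots> \<le> (1/2) ^ Suc c * (2 * (1/2) ^ f n)"
        by (intro mult_left_mono sum_of_new_values h) auto
      finally show "(\<Sum>t<i. W n t) \<le> (1/2) ^ c * (1/2) ^ f n" by simp
    qed
    also have "\<dots> = (1/2) ^ c * (\<Sum>n<i. (1/2) ^ f n)" by (simp add: sum_distrib_left)
    also have "\<dots> \<le> (1/2) ^ c * 2 ^ c"
      using sum_le_suminf[OF sm, of "{..<i}"] c by (intro mult_left_mono) auto
    finally show ?thesis by (simp add: power_one_over)
  qed
  have pos_mono: "pos i + W (fst (prod_decode i)) (snd (prod_decode i)) \<le> pos j" if "i < j" for i j
  proof -
    have "pos (Suc i) \<le> pos j"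
      unfolding pos_def using that by (intro sum_mono2) (auto simp: W_nonneg)
    then show ?thesis by (simp add: pos_def)
  qed
  \<comment> \<open>The last two conditions select the first aligned dyadic interval starting at or
    after \<open>pos i\<close>; it ends before \<open>pos i + 2 * 2^-L\<close>.\<close>
  define P where "P p x i \<longleftrightarrow> act (fst (prod_decode i)) (snd (prod_decode i)) \<and> x = fst (prod_decode i) \<and>
    length (str_of_nat p) = L (fst (prod_decode i)) (snd (prod_decode i)) \<and>
    pos i \<le> real (big_endian (str_of_nat p)) * (1/2) ^ length (str_of_nat p) \<and>
    real (big_endian (str_of_nat p)) * (1/2) ^ length (str_of_nat p) < pos i + (1/2) ^ length (str_of_nat p)" for p x i
  have act_comp: "dec (\<lambda>x. act (u x) (v x))" if "computable u" "computable v" for u v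
    unfolding act_def by (intro comp_intros computable2_apply[OF h(1)] that)
  have L_comp: "computable (\<lambda>x. L (u x) (v x))" if "computable u" "computable v" for u v
    unfolding L_def by (intro comp_intros computable2_apply[OF h(1)] that)
  have rat_2: "rat_computable (\<lambda>x. 2)" and rat_0: "rat_computable (\<lambda>x. 0)"
    using rat_of_nat[OF computable_const[of 2]] rat_of_nat[OF computable_const[of 0]] by simp_all
  have pos_comp: "rat_computable pos"
    unfolding pos_def W_def by (intro comp_intros act_comp L_comp rat_2 rat_0)
  have P_comp: "dec (\<lambda>e. P (fst (prod_decode e)) (fst (prod_decode (snd (prod_decode e))))
      (snd (prod_decode (snd (prod_decode e)))))"
    unfolding P_def by (intro comp_intros act_comp L_comp rat_compose[OF pos_comp] computable_length computable_big_endian)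
  have before: "dyadic (str_of_nat p) + (1/2) ^ length (str_of_nat p) < dyadic (str_of_nat q)"
    if "P p x i" "P q y j" "i < j" for p q x y i j
    using pos_mono[OF that(3)] that(1,2) by (auto simp: P_def W_def dyadic_def)
  have eq: "i = j" if "P p x i" "P q y j" "prefix (str_of_nat p) (str_of_nat q)" for p q x y i j
  proof (rule ccontr)
    assume "i \<noteq> j"
    moreover have "0 < (1/2 :: real) ^ length (str_of_nat p)" "0 < (1/2 :: real) ^ length (str_of_nat q)" by simp_all
    ultimately show False
      using before[OF that(1,2)] before[OF that(2,1)] dyadic_prefix[OF that(3)] by linarith
  qed
  have single: "x = y" if "P p x i" "P p y j" for p x y i j
    using eq[OF that] that by (simp add: P_def)
  obtain M where M0: "computable_machine M"
    "\<forall>p x. M p = Some x \<longleftrightarrow> (\<exists>i. P (nat_of_str p) (nat_of_str x) i)"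
    using P_comp single by (rule computable_machine_of_graph)
  note M = M0(1) M0(2)[rule_format]
  have "prefix_free M"
    unfolding prefix_free_def
  proof (intro ballI impI)
    fix p q assume "p \<in> dom M" "q \<in> dom M" and pq: "prefix p q"
    then obtain x y i j where ij: "P (nat_of_str p) x i" "P (nat_of_str q) y j" using M(2) by blast
    then have "i = j" using eq pq by simp
    then have "length p = length q" using ij by (simp add: P_def)
    then show "p = q" using pq by (auto simp: prefix_def)
  qed
  then have "simulates V M" using V M(1) by (simp add: optimal_prefix_free_def)
  then obtain d where d: "\<And>p x. M p = Some x \<Longrightarrow> complexity V x \<le> length p + d"
    using simulates_complexity by blast
  have "complexity_nat V n \<le> f n + (c + 2 + d)" for n
  proof -
    obtain t0 where t0: "h n t0 = f n" using h(4) by blast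
    \<comment> \<open>At the first stage that shows the final value \<open>f n\<close>, the value is
      new, so a request of length \<open>f n + c + 2\<close> is active.\<close>
    define t where "t = (LEAST t. h n t = f n)"
    have t: "h n t = f n" unfolding t_def using t0 by (rule LeastI)
    have "act n t"
    proof (cases t)
      case (Suc s)
      then have "h n s \<noteq> f n" using not_less_Least[of s "\<lambda>t. h n t = f n"] by (simp add: t_def)
      then show ?thesis using h(3)[of n s] t Suc by (simp add: act_def)
    qed (simp add: act_def)
    define i where "i = prod_encode (n, t)"
    define v where "v = nat \<lceil>pos i * 2 ^ L n t\<rceil>"
    have "pos i + 2 * (1/2) ^ L n t \<le> 1"
      using pos_mono[of i "Suc i"] pos_le_1[of "Suc i"] \<open>act n t\<close> by (simp add: i_def W_def)
    then have le: "pos i * 2 ^ L n t + 2 \<le> 2 ^ L n t"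
      by (simp add: power_one_over field_simps)
    have "0 \<le> pos i" unfolding pos_def by (intro sum_nonneg) (simp add: W_nonneg)
    then have v: "pos i * 2 ^ L n t \<le> real v" "real v < pos i * 2 ^ L n t + 1"
      unfolding v_def by (simp_all add: ceiling_correct) linarith+
    then have "real v < 2 ^ L n t" using le by linarith
    then have "v < 2 ^ L n t" by (metis of_nat_less_iff of_nat_numeral of_nat_power)
    then obtain p where p: "length p = L n t" "big_endian p = v" using big_endian_surj by blast
    have "P (nat_of_str p) n i"
      unfolding P_def using \<open>act n t\<close> p v by (simp add: i_def[symmetric] power_one_over field_simps) (simp add: i_def)
    then have "M p = Some (str_of_nat n)" using M(2) by auto
    from d[OF this] show ?thesis unfolding complexity_nat_def p(1) L_def t by simp
  qed
  then show ?thesis by blast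
qed

section \<open>Checkpoints\<close>

text \<open>
  The state after stage \<open>D + k\<close> is the code of the pair of the last two checkpoints \<open>r \<le> s\<close>. Stage \<open>t\<close>
  becomes a checkpoint when \<open>\<alpha>\<close> has grown since \<open>s\<close> by more than \<open>4^-D\<close> times the growth of \<open>\<beta>\<close>
  between \<open>r\<close> and \<open>s\<close>.
\<close>

definition checkpoints :: "(nat \<Rightarrow> real) \<Rightarrow> (nat \<Rightarrow> real) \<Rightarrow> nat \<Rightarrow> nat \<Rightarrow> nat" where
  "checkpoints \<alpha> \<beta> D = rec_nat (prod_encode (D, D)) (\<lambda>k r.
    if \<alpha> (snd (prod_decode r)) + (1/2) ^ (2 * D) * \<beta> (snd (prod_decode r))
        < \<alpha> (D + Suc k) + (1/2) ^ (2 * D) * \<beta> (fst (prod_decode r))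
    then prod_encode (snd (prod_decode r), D + Suc k) else r)"

definition last_checkpoint :: "(nat \<Rightarrow> real) \<Rightarrow> (nat \<Rightarrow> real) \<Rightarrow> nat \<Rightarrow> nat \<Rightarrow> nat" where
  "last_checkpoint \<alpha> \<beta> D k = snd (prod_decode (checkpoints \<alpha> \<beta> D k))"

text \<open>The increments of \<open>\<alpha>\<close> and \<open>\<beta>\<close> are compared
  without subtraction, in the form that \<open>dec_rat_less\<close> decides.\<close>

definition new_checkpoint :: "(nat \<Rightarrow> real) \<Rightarrow> (nat \<Rightarrow> real) \<Rightarrow> nat \<Rightarrow> nat \<Rightarrow> bool" where
  "new_checkpoint \<alpha> \<beta> D k \<longleftrightarrow>
    \<alpha> (last_checkpoint \<alpha> \<beta> D k) + (1/2) ^ (2 * D) * \<beta> (last_checkpoint \<alpha> \<beta> D k)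
      < \<alpha> (D + Suc k) + (1/2) ^ (2 * D) * \<beta> (fst (prod_decode (checkpoints \<alpha> \<beta> D k)))"

text \<open>In the application \<open>\<alpha> t\<close> is the approximation at stage
  \<open>t\<close> to the sum of \<open>2^-f(n)\<close>, and \<open>\<beta> t\<close> is the
  truncated mass of descriptions found by then.\<close>

locale checkpoint_process =
  fixes \<alpha> \<beta> :: "nat \<Rightarrow> real" and D :: nat
  assumes strict: "\<And>t. \<alpha> t < \<alpha> (Suc t)"
    and mono: "\<And>s t. s \<le> t \<Longrightarrow> \<beta> s \<le> \<beta> t"
    and nonneg: "\<And>t. 0 \<le> \<beta> t"
    and bound: "\<And>t. \<beta> t \<le> 1"
begin

definition R where "R k = fst (prod_decode (checkpoints \<alpha> \<beta> D k))"

abbreviation S where "S \<equiv> last_checkpoint \<alpha> \<beta> D"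
abbreviation new where "new \<equiv> new_checkpoint \<alpha> \<beta> D"
abbreviation \<kappa> :: real where "\<kappa> \<equiv> (1/2) ^ (2 * D)"

lemma new_iff: "new k \<longleftrightarrow> \<alpha> (S k) + \<kappa> * \<beta> (S k) < \<alpha> (D + Suc k) + \<kappa> * \<beta> (R k)"
  by (simp add: new_checkpoint_def R_def)

lemma start: "R 0 = D" "S 0 = D"
  by (simp_all add: R_def last_checkpoint_def checkpoints_def)

lemma step: "R (Suc k) = (if new k then S k else R k)" "S (Suc k) = (if new k then D + Suc k else S k)"
  by (simp_all add: R_def last_checkpoint_def new_checkpoint_def checkpoints_def)

lemma order: "D \<le> R k \<and> R k \<le> S k \<and> S k \<le> D + k"
  by (induction k) (auto simp: start step)

lemma R_mono: "k \<le> l \<Longrightarrow> R k \<le> R l"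
  by (rule lift_Suc_mono_le) (use order step in auto)

lemma S_mono: "k \<le> l \<Longrightarrow> S k \<le> S l"
  by (rule lift_Suc_mono_le) (auto simp: step intro: le_trans[OF conjunct2[OF conjunct2[OF order]]])

lemma \<alpha>_mono: "s \<le> t \<Longrightarrow> \<alpha> s \<le> \<alpha> t"
  by (rule lift_Suc_mono_le) (use strict less_imp_le in auto)

text \<open>At a checkpoint the increment of \<open>\<alpha>\<close> is zero and monotonicity of
  \<open>\<beta>\<close> suffices; at any other stage the inequality says that the test for a
  checkpoint has failed.\<close>

lemma stage_bound: "\<alpha> (D + k) + \<kappa> * \<beta> (R k) \<le> \<alpha> (S k) + \<kappa> * \<beta> (S k)"
proof (cases k)
  case (Suc l)
  show ?thesis
  proof (cases "new l")
    case True
    moreover have "\<beta> (S l) \<le> \<beta> (D + Suc l)" using order[of l] by (intro mono) simp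
    ultimately show ?thesis by (simp add: Suc step mult_left_mono)
  next
    case False
    then show ?thesis using new_iff[of l] by (simp add: Suc step)
  qed
qed (simp add: start)

lemma new_0: "new 0"
  using strict[of D] by (simp add: new_iff start)

text \<open>A potential for termination: a checkpoint moves \<open>R\<close> up to \<open>S\<close>,
  which costs \<open>\<kappa> * (\<beta> (S k) - \<beta> (R k))\<close>, exactly the amount that the
  growth of \<open>\<alpha>\<close> must exceed.\<close>

definition \<Psi> where "\<Psi> k = \<alpha> (S k) - \<kappa> * \<beta> (R k)"

lemma \<Psi>_new: "new k \<Longrightarrow> \<Psi> k < \<Psi> (Suc k)"
  by (simp add: \<Psi>_def step new_iff)

lemma \<Psi>_mono: "k \<le> l \<Longrightarrow> \<Psi> k \<le> \<Psi> l"
proof (rule lift_Suc_mono_le)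
  show "\<Psi> k \<le> \<Psi> (Suc k)" for k
    using \<Psi>_new[of k] by (cases "new k") (auto simp: \<Psi>_def step)
qed

text \<open>With infinitely many checkpoints, \<open>R\<close> is unbounded, and
  \<open>\<Psi>\<close> stays above its value at \<open>k1\<close> by a fixed
  \<open>\<delta> > 0\<close>. But domination from \<open>R k1\<close> on bounds this excess by
  \<open>\<kappa>\<close> times what \<open>\<beta>\<close> still gains after \<open>R k\<close>,
  which tends to 0 as \<open>\<beta>\<close> is bounded.\<close>

lemma finitely_many_checkpoints:
  assumes dominated: "\<exists>t0. \<forall>t\<ge>t0. \<forall>u\<ge>t. \<exists>v\<ge>u. \<alpha> u - \<alpha> t \<le> \<kappa> * (\<beta> v - \<beta> t)"
  shows "finite {k. new k}"
proof (rule ccontr)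
  assume "infinite {k. new k}"
  then have ex: "\<exists>k\<ge>N. new k" for N by (auto simp: infinite_nat_iff_unbounded_le)
  have R_large: "\<exists>k. N \<le> R k" for N
  proof -
    obtain i where i: "i \<ge> N" "new i" using ex by blast
    obtain j where j: "j \<ge> Suc i" "new j" using ex by blast
    have "N \<le> S (Suc i)" using i by (simp add: step)
    also have "\<dots> \<le> S j" using j(1) by (rule S_mono)
    also have "\<dots> = R (Suc j)" using j(2) by (simp add: step)
    finally show ?thesis by blast
  qed
  obtain t0 where t0: "\<forall>t\<ge>t0. \<forall>u\<ge>t. \<exists>v\<ge>u. \<alpha> u - \<alpha> t \<le> \<kappa> * (\<beta> v - \<beta> t)"
    using dominated by blast
  obtain k1 where k1: "t0 \<le> R k1" using R_large by blast
  obtain k2 where k2: "k1 \<le> k2" "new k2" using ex by blast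
  define \<delta> where "\<delta> = \<Psi> (Suc k2) - \<Psi> k1"
  have \<delta>: "0 < \<delta>" using \<Psi>_mono[OF k2(1)] \<Psi>_new[OF k2(2)] by (simp add: \<delta>_def)
  have bdd: "bdd_above (range \<beta>)" using bound by (intro bdd_aboveI[of _ 1]) auto
  have "Sup (range \<beta>) - \<delta> / \<kappa> < Sup (range \<beta>)" using \<delta> by simp
  then obtain s where s: "Sup (range \<beta>) - \<delta> / \<kappa> < \<beta> s"
    using less_cSup_iff[OF _ bdd] by blast
  obtain k3 where k3: "s \<le> R k3" using R_large by blast
  define k where "k = max (Suc k2) k3"
  have "s \<le> R k" using k3 R_mono[of k3 k] by (simp add: k_def)
  then have "Sup (range \<beta>) - \<delta> / \<kappa> < \<beta> (R k)" using s mono by (meson less_le_trans)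
  have "k1 \<le> k" using k2(1) by (simp add: k_def)
  then have "R k1 \<le> S k" using R_mono order le_trans by blast
  then obtain v where v: "\<alpha> (S k) - \<alpha> (R k1) \<le> \<kappa> * (\<beta> v - \<beta> (R k1))" using t0 k1 by blast
  have "\<beta> v \<le> Sup (range \<beta>)" by (rule cSup_upper[OF _ bdd]) simp
  then have "\<beta> v - \<beta> (R k) < \<delta> / \<kappa>" using \<open>Sup (range \<beta>) - \<delta> / \<kappa> < \<beta> (R k)\<close> by linarith
  then have less: "\<kappa> * \<beta> v - \<kappa> * \<beta> (R k) < \<delta>" by (simp add: field_simps)
  have "\<Psi> (Suc k2) \<le> \<Psi> k" by (rule \<Psi>_mono) (simp add: k_def)
  then have "\<delta> + \<alpha> (S k1) - \<kappa> * \<beta> (R k1) \<le> \<alpha> (S k) - \<kappa> * \<beta> (R k)"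
    by (simp add: \<delta>_def \<Psi>_def)
  moreover have "\<alpha> (R k1) \<le> \<alpha> (S k1)" using order by (intro \<alpha>_mono) blast
  moreover have "\<alpha> (S k) - \<alpha> (R k1) \<le> \<kappa> * \<beta> v - \<kappa> * \<beta> (R k1)"
    using v by (simp add: right_diff_distrib)
  ultimately show False using less by linarith
qed

text \<open>After the last checkpoint \<open>R\<close> and \<open>S\<close> are frozen, and
  \<open>stage_bound\<close> turns into a bound on all further growth of \<open>\<alpha>\<close>. As
  \<open>\<alpha>\<close> does grow strictly, the increment of \<open>\<beta>\<close> on the right
  is positive, so that it can be compared with a power \<open>2^-j\<close>.\<close>

lemma final_checkpoint:
  assumes "\<exists>t0. \<forall>t\<ge>t0. \<forall>u\<ge>t. \<exists>v\<ge>u. \<alpha> u - \<alpha> t \<le> \<kappa> * (\<beta> v - \<beta> t)"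
  obtains k where "new k" "\<beta> (S k) < \<beta> (D + Suc k)"
    "\<forall>u\<ge>D + Suc k. \<alpha> u - \<alpha> (D + Suc k) \<le> \<kappa> * (\<beta> (D + Suc k) - \<beta> (S k))"
proof -
  have fin: "finite {k. new k}" using finitely_many_checkpoints[OF assms] .
  define k where "k = Max {k. new k}"
  have k: "new k" using Max_in[OF fin] new_0 unfolding k_def by blast
  have later: "\<not> new l" if "k < l" for l
    using Max_ge[OF fin, of l] that unfolding k_def by auto
  have const: "R (Suc k + i) = S k \<and> S (Suc k + i) = D + Suc k" for i
  proof (induction i)
    case (Suc i)
    then show ?case using later[of "Suc k + i"] by (simp add: step)
  qed (simp add: step k)
  have up: "\<alpha> u - \<alpha> (D + Suc k) \<le> \<kappa> * (\<beta> (D + Suc k) - \<beta> (S k))" if u: "D + Suc k \<le> u" for u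
  proof -
    obtain i where "u = D + (Suc k + i)" using u by (metis add.assoc le_Suc_ex)
    then show ?thesis using stage_bound[of "Suc k + i"] const[of i] by (simp add: right_diff_distrib)
  qed
  have "\<beta> (S k) < \<beta> (D + Suc k)"
  proof (rule ccontr)
    assume "\<not> ?thesis"
    then have "\<kappa> * (\<beta> (D + Suc k) - \<beta> (S k)) \<le> 0" by (intro mult_nonneg_nonpos) auto
    then show False using up[of "Suc (D + Suc k)"] strict[of "D + Suc k"] by simp
  qed
  with k up show ?thesis by (intro that) auto
qed

text \<open>The price of all guesses, right or wrong: each is charged to a separate stretch between
  consecutive checkpoints.\<close>

lemma increments_telescope:
  "(\<Sum>k<K. if new k then \<beta> (D + Suc k) - \<beta> (S k) else 0) \<le> 1"
proof -
  have "(\<Sum>k<K. if new k then \<beta> (D + Suc k) - \<beta> (S k) else 0) = \<beta> (S K) - \<beta> D"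
    by (induction K) (auto simp: start step)
  then show ?thesis using bound[of "S K"] nonneg[of D] by simp
qed

end

section \<open>Cheap positions with small tails\<close>

text \<open>
  Cutting \<open>m\<close> off at a multiple of the current value of \<open>2^-h\<close> makes a late decrease of \<open>h\<close> count as new
  mass of the second sum even if \<open>m\<close> has long been constant.
\<close>

lemma min_sum_dominates:
  fixes m :: "nat \<Rightarrow> nat \<Rightarrow> real" and h :: "nat \<Rightarrow> nat \<Rightarrow> nat" and C :: real
  assumes h: "\<And>n s t. s \<le> t \<Longrightarrow> h n t \<le> h n s" "\<And>n t. f n \<le> h n t" "\<And>n. \<exists>t0. \<forall>t\<ge>t0. h n t = f n"
    and m: "\<And>n s t. s \<le> t \<Longrightarrow> m s n \<le> m t n" "\<And>n t. 0 \<le> m t n"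
    and C: "0 \<le> C" and large: "\<And>n. N \<le> n \<Longrightarrow> \<exists>t. C * (1/2) ^ f n \<le> m t n"
  shows "\<exists>t0. \<forall>t\<ge>t0. \<forall>u\<ge>t. \<exists>v\<ge>u. C * ((\<Sum>n<u. (1/2) ^ h n u) - (\<Sum>n<t. (1/2) ^ h n t))
    \<le> (\<Sum>n<v. min (m v n) (C * (1/2) ^ h n v)) - (\<Sum>n<t. min (m t n) (C * (1/2) ^ h n t))"
proof -
  let ?b = "\<lambda>t n. min (m t n) (C * (1/2) ^ h n t)"
  obtain t1 where t1: "\<forall>t\<ge>t1. \<forall>n<N. h n t = f n"
    using finitely_many_settled[of "\<lambda>n t. h n t = f n" N, OF h(3)] by blast
  have pow: "(1/2 :: real) ^ h n s \<le> (1/2) ^ h n t" if "s \<le> t" for n s t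
    using h(1)[OF that] by (intro power_decreasing) auto
  have b_mono: "?b s n \<le> ?b t n" if "s \<le> t" for n s t
    using m(1)[OF that, of n] mult_left_mono[OF pow[OF that, of n] C] by linarith
  have b_nonneg: "0 \<le> ?b t n" for t n using m(2) C by simp
  have "\<exists>v\<ge>u. C * ((\<Sum>n<u. (1/2) ^ h n u) - (\<Sum>n<t. (1/2) ^ h n t)) \<le> (\<Sum>n<v. ?b v n) - (\<Sum>n<t. ?b t n)"
    if t: "max t1 N \<le> t" and u: "t \<le> u" for t u
  proof -
    have "\<exists>t0. \<forall>t\<ge>t0. N \<le> n \<longrightarrow> C * (1/2) ^ f n \<le> m t n" for n
      using large[of n] m(1)[of _ _ n] by (meson order_trans)
    from finitely_many_settled[of "\<lambda>n t. N \<le> n \<longrightarrow> C * (1/2) ^ f n \<le> m t n", OF this, of u]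
    obtain v0 where v0: "\<forall>v\<ge>v0. \<forall>n<u. N \<le> n \<longrightarrow> C * (1/2) ^ f n \<le> m v n" by blast
    define v where "v = max u v0"
    \<comment> \<open>For \<open>N \<le> n\<close> the second sum has reached its cap
      \<open>C * (1/2) ^ h n v\<close> by stage \<open>v\<close>. For \<open>n < N\<close> the first
      sum no longer changes after \<open>t\<close>.\<close>
    have termwise: "C * ((1/2) ^ h n u - (if n < t then (1/2) ^ h n t else 0)) \<le> ?b v n - (if n < t then ?b t n else 0)"
      if n: "n < u" for n
    proof (cases "N \<le> n")
      case True
      have "C * (1/2) ^ h n v \<le> C * (1/2) ^ f n"
        using h(2) C by (intro mult_left_mono power_decreasing) auto
      also have "\<dots> \<le> m v n" using v0 n True by (simp add: v_def)
      finally have "?b v n = C * (1/2) ^ h n v" by (rule min_absorb2)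
      moreover have "C * (1/2) ^ h n u \<le> C * (1/2) ^ h n v"
        using C by (intro mult_left_mono pow) (simp_all add: v_def)
      moreover have "?b t n \<le> C * (1/2) ^ h n t" by (rule min.cobounded2)
      ultimately have "C * (1/2) ^ h n u \<le> ?b v n"
        "C * (1/2) ^ h n u - C * (1/2) ^ h n t \<le> ?b v n - ?b t n" by linarith+
      then show ?thesis by (cases "n < t") (simp_all add: right_diff_distrib)
    next
      case False
      then have "n < t" "h n u = h n t" using t u t1 by auto
      then show ?thesis using b_mono[of t v n] u by (simp add: v_def)
    qed
    have restrict: "(\<Sum>n<t. F n) = (\<Sum>n<u. if n < t then F n else 0)" for F :: "nat \<Rightarrow> real"
      using u by (subst sum.inter_filter[symmetric]) (auto intro!: sum.cong)
    have "C * ((\<Sum>n<u. (1/2) ^ h n u) - (\<Sum>n<t. (1/2) ^ h n t))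
        = (\<Sum>n<u. C * ((1/2) ^ h n u - (if n < t then (1/2) ^ h n t else 0)))"
      by (simp only: restrict[of "\<lambda>n. (1/2) ^ h n t"] sum_subtractf[symmetric] sum_distrib_left[symmetric])
    also have "\<dots> \<le> (\<Sum>n<u. ?b v n - (if n < t then ?b t n else 0))"
      by (intro sum_mono termwise) simp
    also have "\<dots> = (\<Sum>n<u. ?b v n) - (\<Sum>n<t. ?b t n)"
      by (simp only: restrict[of "?b t"] sum_subtractf)
    also have "(\<Sum>n<u. ?b v n) \<le> (\<Sum>n<v. ?b v n)"
      using b_nonneg by (intro sum_mono2) (auto simp: v_def)
    finally show ?thesis by (intro exI[of _ v]) (simp add: v_def)
  qed
  then show ?thesis by blast
qed

text \<open>\<open>Q D t j\<close> says that \<open>t\<close> is a checkpoint of level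
  \<open>D\<close> and \<open>2^-j\<close> is \<open>2^-D\<close> times the gain of
  \<open>\<beta>\<close> since the previous one, rounded down to a power of 2. Telescoping bounds
  the sum of all prices, and the final checkpoint has the small tail.\<close>

lemma cheap_positions:
  assumes V: "optimal_prefix_free V" and "right_ce f"
    and below: "\<And>c. finite {n. f n \<le> complexity_nat V n + c}"
  obtains Q where
    "dec (\<lambda>e. Q (fst (prod_decode e)) (fst (prod_decode (snd (prod_decode e)))) (snd (prod_decode (snd (prod_decode e)))))"
    "\<forall>D t j. Q D t j \<longrightarrow> D < t"
    "\<forall>D F. finite F \<longrightarrow> F \<subseteq> {(t, j). Q D t j} \<longrightarrow> (\<Sum>(t, j)\<in>F. (1/2) ^ j) \<le> (1/2 :: real) ^ D"
    "\<forall>D. \<exists>t j. Q D t j \<and> (\<forall>N. (\<Sum>n<N. (1/2) ^ f (t + n)) < (2 * (1/2) ^ D * (1/2) ^ j :: real))"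
proof -
  obtain h where h: "computable2 h" "\<And>n s t. s \<le> t \<Longrightarrow> h n t \<le> h n s" "\<And>n t. f n \<le> h n t"
    "\<And>n. \<exists>t0. \<forall>t\<ge>t0. h n t = f n"
    using right_ce_approximation[OF assms(2)] by blast
  have "computable_machine V" using V by (simp add: optimal_prefix_free_def)
  then obtain E where E_comp: "dec (\<lambda>e. E (fst (prod_decode e)) (fst (prod_decode (snd (prod_decode e))))
      (snd (prod_decode (snd (prod_decode e)))))"
    and E: "\<forall>p x. V p = Some x \<longleftrightarrow> (\<exists>t. E (nat_of_str p) (nat_of_str x) t)"
    and E_mono: "\<forall>p x t u. E p x t \<longrightarrow> t \<le> u \<longrightarrow> E p x u"
    by (rule computable_machine_enumeration)
  \<comment> \<open>The total weight of the descriptions of \<open>n\<close> found by stage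
    \<open>t\<close>; it eventually reaches \<open>2^-K(n)\<close>, and Kraft's inequality bounds
    the sum over \<open>n\<close> by 1.\<close>
  define m where "m t n = (\<Sum>p<t. if E p n t then (1/2 :: real) ^ length (str_of_nat p) else 0)" for t n
  define \<alpha> where "\<alpha> t = (\<Sum>n<t. (1/2 :: real) ^ h n t)" for t
  \<comment> \<open>The cap has the form required by \<open>min_sum_dominates\<close> with
    \<open>C = 4^D\<close>.\<close>
  define \<beta> where "\<beta> D t = (\<Sum>n<t. min (m t n) (2 ^ (2 * D) * (1/2) ^ h n t))" for D t
  have m_nonneg: "0 \<le> m t n" for t n unfolding m_def by (intro sum_nonneg) auto
  have m_mono: "m s n \<le> m t n" if "s \<le> t" for s t n
  proof -
    have "m s n \<le> (\<Sum>p<s. if E p n t then (1/2 :: real) ^ length (str_of_nat p) else 0)"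
      unfolding m_def using E_mono that by (intro sum_mono) auto
    also have "\<dots> \<le> m t n" unfolding m_def using that by (intro sum_mono2) auto
    finally show ?thesis .
  qed
  have m_sum: "(\<Sum>n<t. m t n) \<le> 1" for t
  proof -
    let ?F = "{p. p < t \<and> str_of_nat p \<in> dom V}"
    have "(\<Sum>n<t. m t n) = (\<Sum>p<t. \<Sum>n<t. if E p n t then (1/2 :: real) ^ length (str_of_nat p) else 0)"
      unfolding m_def by (rule sum.swap)
    also have "\<dots> \<le> (\<Sum>p<t. if str_of_nat p \<in> dom V then (1/2) ^ length (str_of_nat p) else 0)"
    proof (rule sum_mono)
      fix p
      have V': "V (str_of_nat p) = Some (str_of_nat n)" if "E p n t" for n
        using E that by auto
      show "(\<Sum>n<t. if E p n t then (1/2 :: real) ^ length (str_of_nat p) else 0)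
          \<le> (if str_of_nat p \<in> dom V then (1/2) ^ length (str_of_nat p) else 0)"
      proof (cases "\<exists>n. E p n t")
        case True
        then obtain k where k: "E p k t" by blast
        have single: "n = k" if "E p n t" for n
          using V'[OF that] V'[OF k] by (metis nat_of_str_of_nat option.inject)
        have "(if E p n t then r else 0) \<le> (if n = k then r else 0)" if "0 \<le> r" for n and r :: real
          using single[of n] that by (cases "E p n t") simp_all
        then have "(\<Sum>n<t. if E p n t then (1/2 :: real) ^ length (str_of_nat p) else 0)
            \<le> (\<Sum>n<t. if n = k then (1/2 :: real) ^ length (str_of_nat p) else 0)"
          by (intro sum_mono) simp
        also have "\<dots> \<le> (1/2) ^ length (str_of_nat p)" by simp
        finally show ?thesis using V'[OF k] by auto
      qed auto
    qed
    also have "\<dots> = (\<Sum>p\<in>?F. (1/2) ^ length (str_of_nat p))"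
      by (subst sum.inter_filter[symmetric]) (auto intro: sum.cong)
    also have "\<dots> = (\<Sum>s\<in>str_of_nat ` ?F. (1/2) ^ length s)"
      by (subst sum.reindex) (auto intro: inj_on_inverseI[of _ nat_of_str])
    also have "\<dots> \<le> 1"
      using V by (intro Kraft_inequality[of V]) (auto simp: optimal_prefix_free_def)
    finally show ?thesis .
  qed
  have m_large: "\<exists>t. (1/2) ^ complexity_nat V n \<le> m t n" for n
  proof -
    obtain p where p: "V p = Some (str_of_nat n)" "length p = complexity_nat V n"
      using complexity_witness[OF optimal_prefix_free_total[OF V, of "str_of_nat n"]]
      unfolding complexity_nat_def by blast
    then obtain t where t: "E (nat_of_str p) n t" using E by fastforce
    define u where "u = max t (Suc (nat_of_str p))"
    have "E (nat_of_str p) n u" using t E_mono by (simp add: u_def)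
    then have "(1/2) ^ complexity_nat V n
        \<le> (if E (nat_of_str p) n u then (1/2 :: real) ^ length (str_of_nat (nat_of_str p)) else 0)"
      by (simp add: p(2))
    also have "\<dots> \<le> m u n"
      unfolding m_def by (rule member_le_sum) (auto simp: u_def)
    finally show ?thesis by blast
  qed
  have process: "checkpoint_process \<alpha> (\<beta> D)" for D
  proof
    fix t
    \<comment> \<open>Stage \<open>Suc t\<close> adds the positive summand with index
      \<open>t\<close>, so \<open>\<alpha>\<close> grows strictly even when no value of
      \<open>h\<close> changes.\<close>
    have "\<alpha> t \<le> (\<Sum>n<t. (1/2) ^ h n (Suc t))"
      unfolding \<alpha>_def by (intro sum_mono power_decreasing h) auto
    also have "\<dots> < \<alpha> (Suc t)" by (simp add: \<alpha>_def)
    finally show "\<alpha> t < \<alpha> (Suc t)" .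
    show "0 \<le> \<beta> D t" unfolding \<beta>_def by (intro sum_nonneg) (simp add: m_nonneg)
    have "\<beta> D t \<le> (\<Sum>n<t. m t n)" unfolding \<beta>_def by (intro sum_mono) simp
    with m_sum[of t] show "\<beta> D t \<le> 1" by linarith
  next
    fix s t :: nat
    assume "s \<le> t"
    have "\<beta> D s \<le> (\<Sum>n<s. min (m t n) (2 ^ (2 * D) * (1/2) ^ h n t))"
      unfolding \<beta>_def using \<open>s \<le> t\<close>
      by (intro sum_mono min.mono m_mono mult_left_mono power_decreasing h) auto
    also have "\<dots> \<le> \<beta> D t"
      unfolding \<beta>_def using \<open>s \<le> t\<close> by (intro sum_mono2) (auto simp: m_nonneg)
    finally show "\<beta> D s \<le> \<beta> D t" .
  qed
  have dominated: "\<exists>t0. \<forall>t\<ge>t0. \<forall>u\<ge>t. \<exists>v\<ge>u. \<alpha> u - \<alpha> t \<le> (1/2) ^ (2 * D) * (\<beta> D v - \<beta> D t)" for D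
  proof -
    obtain N where N: "{n. f n \<le> complexity_nat V n + 2 * D} \<subseteq> {..<N}"
      using finite_nat_iff_bounded below by blast
    have "\<exists>t. 2 ^ (2 * D) * (1/2) ^ f n \<le> m t n" if "N \<le> n" for n
    proof -
      have "\<not> f n \<le> complexity_nat V n + 2 * D" using N that by auto
      then have "(1/2 :: real) ^ f n \<le> (1/2) ^ (complexity_nat V n + 2 * D)"
        by (intro power_decreasing) auto
      then have "2 ^ (2 * D) * (1/2 :: real) ^ f n \<le> (1/2) ^ complexity_nat V n"
        by (simp add: power_add power_one_over field_simps)
      then show ?thesis using m_large[of n] by (meson order_trans)
    qed
    from min_sum_dominates[of h f m "2 ^ (2 * D)", OF h(2-4) m_mono m_nonneg _ this]
    have "\<exists>t0. \<forall>t\<ge>t0. \<forall>u\<ge>t. \<exists>v\<ge>u. 2 ^ (2 * D) * (\<alpha> u - \<alpha> t) \<le> \<beta> D v - \<beta> D t"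
      by (simp add: \<alpha>_def \<beta>_def)
    moreover have "2 ^ (2 * D) * (\<alpha> u - \<alpha> t) \<le> \<beta> D v - \<beta> D t \<longleftrightarrow>
        \<alpha> u - \<alpha> t \<le> (1/2) ^ (2 * D) * (\<beta> D v - \<beta> D t)" for u v t
      by (simp add: power_one_over pos_le_divide_eq mult.commute)
    ultimately show ?thesis by simp
  qed
  define last where "last D = last_checkpoint \<alpha> (\<beta> D) D" for D
  define new where "new D = new_checkpoint \<alpha> (\<beta> D) D" for D
  \<comment> \<open>Step \<open>k\<close> of the process examines stage \<open>D + Suc k\<close>, so
    stage \<open>t\<close> belongs to step \<open>t - Suc D\<close>; \<open>D < t\<close> keeps this
    subtraction exact.\<close>
  define Q where "Q D t j \<longleftrightarrow> D < t \<and> new D (t - Suc D) \<and>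
    (1/2) ^ j + (1/2) ^ D * \<beta> D (last D (t - Suc D)) \<le> (1/2) ^ D * \<beta> D t \<and>
    (1/2) ^ D * \<beta> D t < 2 * (1/2) ^ j + (1/2) ^ D * \<beta> D (last D (t - Suc D))" for D t j
  show ?thesis
  proof (rule that[of Q])
    have rat: "rat_computable (\<lambda>x. 2)" "rat_computable (\<lambda>x. 0)"
      using rat_of_nat[OF computable_const[of 2]] rat_of_nat[OF computable_const[of 0]] by simp_all
    have \<alpha>_comp: "rat_computable (\<lambda>x. \<alpha> (u x))" if "computable u" for u
      by (rule rat_compose[OF _ that])
        (unfold \<alpha>_def, intro comp_intros computable2_apply[OF h(1)])
    have two_power: "rat_computable (\<lambda>x. 2 ^ (2 * u x))" if "computable u" for u
      using rat_of_nat[OF computable_power[OF computable_const[of 2] computable_mult[OF computable_const[of 2] that]]]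
      by simp
    have E_comp': "dec (\<lambda>x. E (p x) (n x) (t x))" if "computable p" "computable n" "computable t" for p n t
      using dec_compose[OF E_comp computable_pair[OF that(1) computable_pair[OF that(2,3)]]] by simp
    have m_comp: "rat_computable (\<lambda>x. m (u x) (v x))" if "computable u" "computable v" for u v
      by (rule rat_compose2[OF _ that, of m])
        (unfold m_def, intro comp_intros rat computable_length E_comp')
    have \<beta>_comp: "rat_computable (\<lambda>x. \<beta> (u x) (v x))" if "computable u" "computable v" for u v
      by (rule rat_compose2[OF _ that, of \<beta>])
        (unfold \<beta>_def, intro comp_intros m_comp two_power computable2_apply[OF h(1)])
    have ck_comp: "computable (\<lambda>x. checkpoints \<alpha> (\<beta> (u x)) (u x) (v x))" if "computable u" "computable v" for u v
    proof -
      have "computable2 (\<lambda>D k. checkpoints \<alpha> (\<beta> D) D k)"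
        unfolding checkpoints_def
        by (rule computable2I) (intro computable_rec comp_intros \<alpha>_comp \<beta>_comp)
      from computable2_apply[OF this that] show ?thesis .
    qed
    have last_comp: "computable (\<lambda>x. last (u x) (v x))" if "computable u" "computable v" for u v
      unfolding last_def last_checkpoint_def by (intro comp_intros ck_comp that)
    have new_comp: "dec (\<lambda>x. new (u x) (v x))" if "computable u" "computable v" for u v
      unfolding new_def new_checkpoint_def last_checkpoint_def
      by (intro comp_intros ck_comp \<alpha>_comp \<beta>_comp that)
    show "dec (\<lambda>e. Q (fst (prod_decode e)) (fst (prod_decode (snd (prod_decode e)))) (snd (prod_decode (snd (prod_decode e)))))"
      unfolding Q_def by (intro comp_intros last_comp new_comp \<beta>_comp rat)
    show "\<forall>D t j. Q D t j \<longrightarrow> D < t" by (simp add: Q_def)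
    show "\<forall>D F. finite F \<longrightarrow> F \<subseteq> {(t, j). Q D t j} \<longrightarrow> (\<Sum>(t, j)\<in>F. (1/2) ^ j) \<le> (1/2 :: real) ^ D"
    proof (intro allI impI)
      fix D F
      assume F: "finite F" "F \<subseteq> {(t, j). Q D t j}"
      interpret checkpoint_process \<alpha> "\<beta> D" D by (rule process)
      define q where "q k = (if new D k then \<beta> D (D + Suc k) - \<beta> D (last D k) else 0)" for k
      have q_nonneg: "0 \<le> q k" for k
        using order[of k] mono[of "S k" "D + Suc k"] by (simp add: q_def last_def)
      have Qq: "(1/2) ^ j \<le> (1/2) ^ D * q (t - Suc D)" "(1/2) ^ D * q (t - Suc D) < 2 * (1/2) ^ j" "D < t"
        if "(t, j) \<in> F" for t j
        using F(2) that by (auto simp: Q_def q_def right_diff_distrib)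
      \<comment> \<open>The two inequalities in \<open>Q\<close> determine \<open>j\<close> from
        \<open>t\<close>, so no gain of \<open>\<beta>\<close> is charged twice.\<close>
      have j_eq: "j = i" if "(t, j) \<in> F" "(t, i) \<in> F" for t i j
      proof -
        have "\<not> j < i" if "(t, j) \<in> F" "(t, i) \<in> F" for i j
        proof
          assume "j < i"
          then have "(1/2 :: real) ^ i \<le> (1/2) ^ Suc j" by (intro power_decreasing) auto
          then show False using Qq(1)[OF that(1)] Qq(2)[OF that(2)] by simp
        qed
        then show ?thesis using that by (meson linorder_cases)
      qed
      have inj: "inj_on (\<lambda>(t, j). t - Suc D) F"
      proof (rule inj_onI, clarify)
        fix t j t' j'
        assume tj: "(t, j) \<in> F" "(t', j') \<in> F" "t - Suc D = t' - Suc D"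
        then have "t = t'" using Qq(3)[of t j] Qq(3)[of t' j'] by simp
        then show "t = t' \<and> j = j'" using j_eq tj by blast
      qed
      obtain K where K: "(\<lambda>(t, j). t - Suc D) ` F \<subseteq> {..<K}"
        using finite_nat_iff_bounded F(1) by blast
      have "(\<Sum>(t, j)\<in>F. (1/2 :: real) ^ j) \<le> (\<Sum>(t, j)\<in>F. (1/2) ^ D * q (t - Suc D))"
        by (rule sum_mono) (use Qq(1) in auto)
      also have "\<dots> = (\<Sum>k\<in>(\<lambda>(t, j). t - Suc D) ` F. (1/2) ^ D * q k)"
        by (subst sum.reindex[OF inj]) (simp add: case_prod_beta)
      also have "\<dots> \<le> (\<Sum>k<K. (1/2) ^ D * q k)"
        using K q_nonneg by (intro sum_mono2) auto
      also have "\<dots> = (1/2) ^ D * (\<Sum>k<K. q k)" by (simp add: sum_distrib_left)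
      also have "\<dots> \<le> (1/2) ^ D * 1"
        using increments_telescope[of K] unfolding q_def new_def last_def by (intro mult_left_mono) auto
      finally show "(\<Sum>(t, j)\<in>F. (1/2) ^ j) \<le> (1/2 :: real) ^ D" by simp
    qed
    show "\<forall>D. \<exists>t j. Q D t j \<and> (\<forall>N. (\<Sum>n<N. (1/2) ^ f (t + n)) < (2 * (1/2) ^ D * (1/2) ^ j :: real))"
    proof
      fix D
      interpret checkpoint_process \<alpha> "\<beta> D" D by (rule process)
      obtain k where k: "new D k" "\<beta> D (last D k) < \<beta> D (D + Suc k)"
        "\<forall>u\<ge>D + Suc k. \<alpha> u - \<alpha> (D + Suc k) \<le> (1/2) ^ (2 * D) * (\<beta> D (D + Suc k) - \<beta> D (last D k))"
        using dominated[of D] unfolding new_def last_def by (rule final_checkpoint)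
      define t where "t = D + Suc k"
      define q where "q = (1/2) ^ D * (\<beta> D t - \<beta> D (last D k))"
      have "0 < q" using k(2) by (simp add: q_def t_def)
      have "q \<le> 1"
      proof -
        have "q \<le> 1 * (\<beta> D t - \<beta> D (last D k))"
          unfolding q_def using k(2) by (intro mult_right_mono power_le_one) (auto simp: t_def)
        then show ?thesis using bound[of t] nonneg[of "last D k"] by simp
      qed
      obtain i where i: "(1/2 :: real) ^ i < q"
        using real_arch_pow_inv[OF \<open>0 < q\<close>, of "1/2"] by auto
      define j where "j = (LEAST j. (1/2) ^ j \<le> q)"
      have j: "(1/2) ^ j \<le> q" unfolding j_def using less_imp_le[OF i] by (rule LeastI)
      have j': "q < 2 * (1/2) ^ j"
      proof (cases j)
        case 0
        then show ?thesis using \<open>q \<le> 1\<close> by simp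
      next
        case (Suc l)
        then have "\<not> (1/2) ^ l \<le> q" using not_less_Least[of l "\<lambda>j. (1/2) ^ j \<le> q"] by (simp add: j_def)
        then show ?thesis using Suc by simp
      qed
      have "Q D t j"
        unfolding Q_def using k(1) j j' by (simp add: q_def t_def right_diff_distrib)
      moreover have "(\<Sum>n<N. (1/2) ^ f (t + n)) < (2 * (1/2) ^ D * (1/2) ^ j :: real)" for N
      proof -
        obtain t0 where t0: "\<forall>u\<ge>t0. \<forall>n<t + N. h n u = f n"
          using finitely_many_settled[of "\<lambda>n t. h n t = f n", OF h(4)] by blast
        \<comment> \<open>By stage \<open>u\<close> all values below \<open>t + N\<close> are final.
          Since \<open>h\<close> only decreases, \<open>\<alpha> t\<close> is at most the part of
          \<open>\<alpha> u\<close> below \<open>t\<close>, and the difference bounds the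
          tail.\<close>
        define u where "u = max t0 (t + N)"
        have "(\<Sum>n<t + N. (1/2 :: real) ^ h n u) = (\<Sum>n<t. (1/2) ^ h n u) + (\<Sum>n<N. (1/2) ^ h (t + n) u)"
          by (induction N) simp_all
        moreover have "(\<Sum>n<N. (1/2 :: real) ^ h (t + n) u) = (\<Sum>n<N. (1/2) ^ f (t + n))"
          using t0 by (simp add: u_def)
        moreover have "(\<Sum>n<t + N. (1/2) ^ h n u) \<le> \<alpha> u"
          unfolding \<alpha>_def by (intro sum_mono2) (auto simp: u_def)
        moreover have "\<alpha> t \<le> (\<Sum>n<t. (1/2) ^ h n u)"
          unfolding \<alpha>_def by (intro sum_mono power_decreasing h) (auto simp: u_def)
        ultimately have "(\<Sum>n<N. (1/2) ^ f (t + n)) \<le> \<alpha> u - \<alpha> t" by linarith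
        also have "\<dots> \<le> (1/2) ^ (2 * D) * (\<beta> D t - \<beta> D (last D k))"
          using k(3) by (simp add: t_def u_def)
        \<comment> \<open>One half of \<open>4^-D\<close> is contained in \<open>q\<close>, hence in
          the price \<open>2^-j\<close>; the other half remains as the small factor.\<close>
        also have "\<dots> = (1/2) ^ D * q" by (simp add: q_def mult_2 power_add)
        also have "\<dots> < (1/2) ^ D * (2 * (1/2) ^ j)" using j' by (intro mult_strict_left_mono) auto
        finally show ?thesis by simp
      qed
      ultimately show "\<exists>t j. Q D t j \<and> (\<forall>N. (\<Sum>n<N. (1/2) ^ f (t + n)) < (2 * (1/2) ^ D * (1/2) ^ j :: real))"
        by blast
    qed
  qed
qed

section \<open>A non-random sequence of high complexity\<close>

lemma measure_UN_le:
  assumes "\<And>i. E i \<in> sets cantor_measure" "\<And>i. measure cantor_measure (E i) \<le> c i"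
    and "\<And>N. (\<Sum>i<N. c i) \<le> C"
  shows "measure cantor_measure (\<Union>i::nat. E i) \<le> C"
proof -
  have le: "(\<Sum>i<N. measure cantor_measure (E i)) \<le> C" for N
    using sum_mono[of "{..<N}" "\<lambda>i. measure cantor_measure (E i)" c] assms(2) assms(3)[of N] by fastforce
  have sm: "summable (\<lambda>i. measure cantor_measure (E i))"
    by (rule summableI_nonneg_bounded[OF _ le]) simp
  have "measure cantor_measure (\<Union>i. E i) \<le> (\<Sum>i. measure cantor_measure (E i))"
    by (rule cantor.finite_measure_subadditive_countably) (use assms(1) sm in auto)
  also have "\<dots> \<le> C" by (rule suminf_le_const[OF sm le])
  finally show ?thesis .
qed

lemma measure_extensions:
  assumes X: "finite X" "\<And>x. x \<in> X \<Longrightarrow> length x = t"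
  shows "measure cantor_measure (\<Union>x\<in>X. cyl (x @ replicate j False)) = real (card X) * (1/2) ^ (t + j)"
proof -
  let ?Y = "(\<lambda>x. x @ replicate j False) ` X"
  have "measure cantor_measure (\<Union>y\<in>?Y. cyl y) = real (card ?Y) * (1/2) ^ (t + j)"
    by (rule measure_UN_cyl_same_length) (use X in auto)
  moreover have "card ?Y = card X" by (rule card_image) (simp add: inj_on_def)
  ultimately show ?thesis by simp
qed

section \<open>Blocks of zeros and the test that they form\<close>

definition zero_block :: "nat \<Rightarrow> nat \<Rightarrow> (nat \<Rightarrow> bool) set" where
  "zero_block t j = {A. \<forall>i<j. \<not> A (t + i)}"

lemma zero_block_eq: "zero_block t j = (\<Union>x\<in>{x. length x = t}. cyl (x @ replicate j False))"
proof (intro set_eqI iffI)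
  fix A assume "A \<in> zero_block t j"
  then have "A \<in> cyl (initial A t @ replicate j False)"
    unfolding in_cyl_iff zero_block_def by (auto simp: nth_append nth_initial) (metis add_diff_inverse_nat less_diff_conv2 linorder_not_less add.commute add_less_cancel_left)
  then show "A \<in> (\<Union>x\<in>{x. length x = t}. cyl (x @ replicate j False))" by force
next
  fix A assume "A \<in> (\<Union>x\<in>{x. length x = t}. cyl (x @ replicate j False))"
  then obtain x where "length x = t" "A \<in> cyl (x @ replicate j False)" by blast
  then show "A \<in> zero_block t j"
    unfolding in_cyl_iff zero_block_def by (auto simp: nth_append dest: spec[of _ "t + _"])
qed

lemma zero_block_sets: "zero_block t j \<in> sets cantor_measure"
  unfolding zero_block_eq by (rule sets.finite_UN[OF finite_strings]) simp

lemma measure_zero_block: "measure cantor_measure (zero_block t j) = (1/2) ^ j"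
proof -
  have "card {x :: bool list. length x = t} = 2 ^ t"
    using card_lists_length_eq[of "UNIV :: bool set" t] by simp
  then show ?thesis
    unfolding zero_block_eq using measure_extensions[OF finite_strings[of t], of t j]
    by (simp add: power_add power_one_over)
qed

text \<open>Only levels \<open>D > d\<close> enter, whose total prices \<open>2^-D\<close> add up to
  \<open>2^-d\<close>. The guard \<open>t + i < length s\<close> gives the condition on bits the
  form that \<open>dec_nth\<close> decides.\<close>

definition block_test :: "(nat \<Rightarrow> nat \<Rightarrow> nat \<Rightarrow> bool) \<Rightarrow> nat \<Rightarrow> bool list set" where
  "block_test Q d = {s. \<exists>D t j. d < D \<and> Q D t j \<and> length s = t + j \<and>
    (\<forall>i<j. \<not> (t + i < length s \<and> s ! (t + i)))}"

lemma block_test_ml_test: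
  assumes Q: "dec (\<lambda>e. Q (fst (prod_decode e)) (fst (prod_decode (snd (prod_decode e)))) (snd (prod_decode (snd (prod_decode e)))))"
    and cost: "\<forall>D F. finite F \<longrightarrow> F \<subseteq> {(t, j). Q D t j} \<longrightarrow> (\<Sum>(t, j)\<in>F. (1/2) ^ j) \<le> (1/2 :: real) ^ D"
  shows "ml_test (block_test Q)"
  unfolding ml_test_def
proof (intro conjI allI)
  define P where "P y e \<longleftrightarrow> fst (prod_decode y) < fst (prod_decode e) \<and>
    Q (fst (prod_decode e)) (fst (prod_decode (snd (prod_decode e)))) (snd (prod_decode (snd (prod_decode e)))) \<and>
    length (str_of_nat (snd (prod_decode y)))
      = fst (prod_decode (snd (prod_decode e))) + snd (prod_decode (snd (prod_decode e))) \<and>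
    (\<forall>i<snd (prod_decode (snd (prod_decode e))).
      \<not> (fst (prod_decode (snd (prod_decode e))) + i < length (str_of_nat (snd (prod_decode y))) \<and>
        str_of_nat (snd (prod_decode y)) ! (fst (prod_decode (snd (prod_decode e))) + i)))" for y e
  have "dec (\<lambda>e. P (fst (prod_decode e)) (snd (prod_decode e)))"
    unfolding P_def by (intro comp_intros dec_compose[OF Q] computable_length dec_nth)
  then have "ce {y. \<exists>e. P y e}" by (rule ce_exists)
  moreover have "{prod_encode (n, nat_of_str s) |n s. s \<in> block_test Q n} = {y. \<exists>e. P y e}"
  proof (intro set_eqI iffI)
    fix y assume "y \<in> {prod_encode (n, nat_of_str s) |n s. s \<in> block_test Q n}"
    then obtain n s where y: "y = prod_encode (n, nat_of_str s)" "s \<in> block_test Q n" by blast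
    then obtain D t j where "n < D \<and> Q D t j \<and> length s = t + j \<and>
        (\<forall>i<j. \<not> (t + i < length s \<and> s ! (t + i)))" unfolding block_test_def by blast
    then have "P y (prod_encode (D, prod_encode (t, j)))" unfolding P_def y(1) by simp
    then show "y \<in> {y. \<exists>e. P y e}" by blast
  next
    fix y assume "y \<in> {y. \<exists>e. P y e}"
    then have "str_of_nat (snd (prod_decode y)) \<in> block_test Q (fst (prod_decode y))"
      unfolding P_def block_test_def by blast
    moreover have "y = prod_encode (fst (prod_decode y), nat_of_str (str_of_nat (snd (prod_decode y))))" by simp
    ultimately show "y \<in> {prod_encode (n, nat_of_str s) |n s. s \<in> block_test Q n}" by blast
  qed
  ultimately show "ce {prod_encode (n, nat_of_str s) |n s. s \<in> block_test Q n}" by simp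
next
  fix d
  define E where "E D n = (if Q D (fst (prod_decode n)) (snd (prod_decode n))
    then zero_block (fst (prod_decode n)) (snd (prod_decode n)) else {})" for D n
  have E_sets: "E D n \<in> sets cantor_measure" for D n by (simp add: E_def zero_block_sets)
  have "measure cantor_measure (\<Union>n. E D n) \<le> (1/2) ^ D" for D
  proof (rule measure_UN_le[OF E_sets])
    let ?c = "\<lambda>n. if Q D (fst (prod_decode n)) (snd (prod_decode n)) then (1/2 :: real) ^ snd (prod_decode n) else 0"
    show "measure cantor_measure (E D n) \<le> ?c n" for n
      by (simp add: E_def measure_zero_block)
    show "(\<Sum>n<N. ?c n) \<le> (1/2) ^ D" for N
    proof -
      let ?G = "{n. n < N \<and> Q D (fst (prod_decode n)) (snd (prod_decode n))}"
      have "(\<Sum>n<N. ?c n) = (\<Sum>n\<in>?G. (1/2) ^ snd (prod_decode n))"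
        by (subst sum.inter_filter[symmetric]) (auto intro: sum.cong)
      also have "\<dots> = (\<Sum>(t, j)\<in>prod_decode ` ?G. (1/2) ^ j)"
        by (subst sum.reindex) (auto intro: inj_on_subset[OF inj_prod_decode] simp: case_prod_beta)
      also have "\<dots> \<le> (1/2) ^ D"
      proof (rule cost[rule_format])
        show "prod_decode ` ?G \<subseteq> {(t, j). Q D t j}"
          by (rule image_subsetI) (simp add: case_prod_beta)
      qed simp
      finally show ?thesis .
    qed
  qed
  then have "measure cantor_measure (\<Union>i. \<Union>n. E (d + Suc i) n) \<le> (1/2) ^ d"
  proof (rule measure_UN_le[rotated])
    have "(\<Sum>i<N. (1/2 :: real) ^ (d + Suc i)) = (1/2) ^ d - (1/2) ^ (d + N)" for N
      by (induction N) (simp_all add: power_add)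
    then show "(\<Sum>i<N. (1/2 :: real) ^ (d + Suc i)) \<le> (1/2) ^ d" for N by simp
  qed (use E_sets in auto)
  moreover have "cylinders (block_test Q d) \<subseteq> (\<Union>i. \<Union>n. E (d + Suc i) n)"
  proof
    fix A assume "A \<in> cylinders (block_test Q d)"
    then obtain l D t j where l: "d < D" "Q D t j" "l = t + j"
      "\<forall>i<j. \<not> (t + i < l \<and> initial A l ! (t + i))"
      unfolding cylinders_def block_test_def by auto
    then have "A \<in> zero_block t j" by (auto simp: zero_block_def nth_initial)
    then have "A \<in> E D (prod_encode (t, j))" using l(2) by (simp add: E_def)
    moreover obtain i where "D = d + Suc i" using l(1) less_iff_Suc_add by auto
    ultimately show "A \<in> (\<Union>i. \<Union>n. E (d + Suc i) n)" by blast
  qed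
  moreover have "(\<Union>i. \<Union>n. E (d + Suc i) n) \<in> sets cantor_measure"
    using E_sets by (intro sets.countable_UN image_subsetI)
  ultimately show "measure cantor_measure (cylinders (block_test Q d)) \<le> (1/2) ^ d"
    using cantor.finite_measure_mono order_trans by blast
qed

text \<open>Nested cylinders, each meeting \<open>G\<close> in positive measure, shrink to a
  sequence in all components of the test. The limit satisfies the bound because \<open>G\<close> is
  closed: a violation already shows in a finite prefix.\<close>

lemma complex_nonrandom_sequence:
  assumes U: "optimal_plain U" and V: "optimal_prefix_free V" and f: "right_ce f"
    and sm: "summable (\<lambda>n. (1/2 :: real) ^ f n)"
    and below: "\<And>c. finite {n. f n \<le> complexity_nat V n + c}"
  shows "\<exists>A c. (\<forall>n. int n - int (f n) - c \<le> int (complexity U (initial A n))) \<and> \<not> ml_random A"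
proof -
  obtain Q where Q: "dec (\<lambda>e. Q (fst (prod_decode e)) (fst (prod_decode (snd (prod_decode e)))) (snd (prod_decode (snd (prod_decode e)))))"
    and late: "\<forall>D t j. Q D t j \<longrightarrow> D < t"
    and cost: "\<forall>D F. finite F \<longrightarrow> F \<subseteq> {(t, j). Q D t j} \<longrightarrow> (\<Sum>(t, j)\<in>F. (1/2) ^ j) \<le> (1/2 :: real) ^ D"
    and tail: "\<forall>D. \<exists>t j. Q D t j \<and> (\<forall>N. (\<Sum>n<N. (1/2) ^ f (t + n)) < (2 * (1/2) ^ D * (1/2) ^ j :: real))"
    using V f below by (rule cheap_positions)
  \<comment> \<open>With this \<open>c\<close> the sequences violating the bound somewhere have
    total measure below 1, so \<open>G\<close> has positive measure.\<close>
  obtain c where c: "2 * suminf (\<lambda>n. (1/2 :: real) ^ f n) < 2 ^ c"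
    using real_arch_pow[of 2] by auto
  define bad where "bad x \<longleftrightarrow> int (complexity U x) < int (length x) - int (f (length x)) - int c" for x
  define B where "B n = (\<Union>x\<in>{x. length x = n \<and> bad x}. cyl x)" for n
  have fin: "finite {x. length x = n \<and> bad x}" for n
    by (rule finite_subset[OF _ finite_strings[of n]]) auto
  have B_iff: "A \<in> B n \<longleftrightarrow> bad (initial A n)" for A n
    unfolding B_def by (auto simp: cyl_def)
  have B_sets: "B n \<in> sets cantor_measure" for n
    unfolding B_def by (rule sets.finite_UN[OF fin]) simp
  \<comment> \<open>Fewer than \<open>2 ^ m\<close> strings have complexity below
    \<open>m = n - f n - c\<close>; if that number is negative, no string of length \<open>n\<close>
    is bad.\<close>
  have B_le: "measure cantor_measure (B n) \<le> (1/2) ^ c * (1/2) ^ f n" for n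
  proof (cases "f n + c \<le> n")
    case True
    let ?m = "n - (f n + c)"
    have sub: "{x. length x = n \<and> bad x} \<subseteq> {x. complexity U x < ?m}"
      using True by (auto simp: bad_def)
    have low: "finite {x. complexity U x < ?m} \<and> card {x. complexity U x < ?m} < 2 ^ ?m"
      by (rule card_low_complexity[OF optimal_plain_total[OF U]])
    have "card {x. length x = n \<and> bad x} \<le> 2 ^ ?m"
      using card_mono[OF _ sub] low by linarith
    then have "real (card {x. length x = n \<and> bad x}) \<le> 2 ^ ?m"
      by (metis of_nat_le_iff of_nat_numeral of_nat_power)
    then have "measure cantor_measure (B n) \<le> 2 ^ ?m * (1/2) ^ n"
      unfolding B_def by (subst measure_UN_cyl_same_length[OF fin]) auto
    also have "(2 :: real) ^ ?m * (1/2) ^ n = (1/2) ^ c * (1/2) ^ f n"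
      using True by (simp add: power_diff power_add power_one_over)
    finally show ?thesis .
  next
    case False
    then have "{x. length x = n \<and> bad x} = {}" by (auto simp: bad_def)
    then have "B n = {}" unfolding B_def by (simp only: UN_empty)
    then show ?thesis by simp
  qed
  have tail_le: "measure cantor_measure (\<Union>n. B (t + n)) \<le> (1/2) ^ c * r"
    if "\<And>N. (\<Sum>n<N. (1/2) ^ f (t + n)) \<le> r" for t r
  proof (rule measure_UN_le[OF B_sets B_le])
    show "(\<Sum>n<N. (1/2) ^ c * (1/2) ^ f (t + n)) \<le> (1/2) ^ c * r" for N
      using that[of N] by (simp add: sum_distrib_left[symmetric])
  qed
  define G where "G = space cantor_measure - (\<Union>n. B n)"
  have G_sets: "G \<in> sets cantor_measure" using B_sets by (auto simp: G_def)
  have G_iff: "A \<in> G \<longleftrightarrow> (\<forall>n. \<not> bad (initial A n))" for A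
    by (simp add: G_def space_cantor B_iff)

  have extend: "\<exists>\<sigma>'. prefix \<sigma> \<sigma>' \<and> length \<sigma> < length \<sigma>' \<and> \<sigma>' \<in> block_test Q d \<and>
      0 < measure cantor_measure (G \<inter> cyl \<sigma>')"
    if \<sigma>: "0 < measure cantor_measure (G \<inter> cyl \<sigma>)" for \<sigma> d
  proof -
    define \<epsilon> where "\<epsilon> = measure cantor_measure (G \<inter> cyl \<sigma>)"
    obtain D0 where D0: "(1/2) ^ D0 < \<epsilon> / 2"
      using real_arch_pow_inv[of "\<epsilon> / 2" "1/2"] \<sigma> by (auto simp: \<epsilon>_def)
    \<comment> \<open>\<open>D0\<close> makes the tail small against \<open>\<epsilon>\<close>,
      \<open>Suc d\<close> puts the block into component \<open>d\<close> of the test, and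
      \<open>length \<sigma>\<close> puts its position \<open>t > D\<close> beyond the end of
      \<open>\<sigma>\<close>.\<close>
    define D where "D = max D0 (max (Suc d) (length \<sigma>))"
    have "(1/2 :: real) ^ D \<le> (1/2) ^ D0" by (intro power_decreasing) (auto simp: D_def)
    then have D: "2 * (1/2) ^ D < \<epsilon>" using D0 by linarith
    obtain t j where tj: "Q D t j" "\<And>N. (\<Sum>n<N. (1/2) ^ f (t + n)) < (2 * (1/2) ^ D * (1/2) ^ j :: real)"
      using tail by blast
    have t: "length \<sigma> < t" using late tj(1) by (force simp: D_def)
    \<comment> \<open>Only prefixes shorter than \<open>t\<close> are required not to be bad; bad
      strings of length at least \<open>t\<close> are left to the tail estimate.\<close>
    define X where "X = {x. length x = t \<and> prefix \<sigma> x \<and> (\<forall>n<t. \<not> bad (take n x))}"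
    have X: "finite X" "\<And>x. x \<in> X \<Longrightarrow> length x = t"
      by (rule finite_subset[OF _ finite_strings[of t]]) (auto simp: X_def)
    have take_initial: "take n (initial A t) = initial A n" if "n < t" for n A
      using that by (simp add: initial_def take_map)
    have "G \<inter> cyl \<sigma> \<subseteq> (\<Union>x\<in>X. cyl x)"
    proof
      fix A assume A: "A \<in> G \<inter> cyl \<sigma>"
      then have "prefix \<sigma> (initial A t)"
        using prefix_initial[of "length \<sigma>" t A] t by (simp add: cyl_def)
      then have "initial A t \<in> X" using A by (simp add: X_def take_initial G_iff)
      then show "A \<in> (\<Union>x\<in>X. cyl x)" by (intro UN_I[of "initial A t"]) (simp_all add: cyl_def)
    qed
    then have "\<epsilon> \<le> measure cantor_measure (\<Union>x\<in>X. cyl x)"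
      unfolding \<epsilon>_def using X(1) by (intro cantor.finite_measure_mono sets.finite_UN) auto
    also have "\<dots> = real (card X) * (1/2) ^ t" by (rule measure_UN_cyl_same_length[OF X])
    finally have \<epsilon>: "\<epsilon> \<le> real (card X) * (1/2) ^ t" .
    \<comment> \<open>Appending \<open>j\<close> zeros keeps measure at least
      \<open>\<epsilon> * 2^-j\<close>. If none of it lay in \<open>G\<close>, up to a null set, all
      of it would be covered by bad strings of length at least \<open>t\<close>, whose measure
      carries the same factor \<open>2^-j\<close>. Cancelling it leaves
      \<open>\<epsilon> \<le> 2 * 2^-D\<close>, against the choice of \<open>D\<close>.\<close>
    have "\<exists>x\<in>X. measure cantor_measure (G \<inter> cyl (x @ replicate j False)) \<noteq> 0"
    proof (rule ccontr)
      assume "\<not> ?thesis"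
      then have zero: "measure cantor_measure (G \<inter> cyl (x @ replicate j False)) = 0" if "x \<in> X" for x
        using that by blast
      let ?N = "\<Union>x\<in>X. G \<inter> cyl (x @ replicate j False)"
      let ?T = "\<Union>n. B (t + n)"
      have N_sets: "?N \<in> sets cantor_measure"
        using X(1) G_sets by (intro sets.finite_UN sets.Int sets_cyl)
      have T_sets: "?T \<in> sets cantor_measure"
        using B_sets by auto
      have "measure cantor_measure ?N \<le> (\<Sum>x\<in>X. measure cantor_measure (G \<inter> cyl (x @ replicate j False)))"
        using X(1) G_sets by (intro cantor.finite_measure_subadditive_finite) auto
      also have "\<dots> = 0" using zero by simp
      finally have N: "measure cantor_measure ?N \<le> 0" .
      have T: "measure cantor_measure ?T \<le> (1/2) ^ c * (2 * (1/2) ^ D * (1/2) ^ j)"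
        by (rule tail_le) (rule less_imp_le[OF tj(2)])
      have "(\<Union>x\<in>X. cyl (x @ replicate j False)) \<subseteq> ?N \<union> ?T"
      proof
        fix A assume "A \<in> (\<Union>x\<in>X. cyl (x @ replicate j False))"
        then obtain x where x: "x \<in> X" "A \<in> cyl (x @ replicate j False)" by blast
        have "A \<in> cyl x" using cyl_append_subset x(2) by blast
        then have xA: "x = initial A t" using X(2)[OF x(1)] by (simp add: cyl_def)
        show "A \<in> ?N \<union> ?T"
        proof (cases "A \<in> G")
          case False
          then obtain n where n: "bad (initial A n)" by (auto simp: G_iff)
          then have "\<not> n < t" using x(1) by (auto simp: X_def xA take_initial)
          then have "A \<in> B (t + (n - t))" using n by (simp add: B_iff)
          then show ?thesis by blast
        qed (use x in blast)
      qed
      then have "measure cantor_measure (\<Union>x\<in>X. cyl (x @ replicate j False)) \<le> measure cantor_measure (?N \<union> ?T)"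
        by (rule cantor.finite_measure_mono) (rule sets.Un[OF N_sets T_sets])
      also have "\<dots> \<le> measure cantor_measure ?N + measure cantor_measure ?T"
        by (rule measure_Un_le[OF N_sets T_sets])
      also have "\<dots> \<le> (1/2) ^ c * (2 * (1/2) ^ D * (1/2) ^ j)" using N T by linarith
      also have "\<dots> \<le> 1 * (2 * (1/2) ^ D * (1/2) ^ j)"
        by (intro mult_right_mono power_le_one) auto
      also have "measure cantor_measure (\<Union>x\<in>X. cyl (x @ replicate j False)) = real (card X) * (1/2) ^ (t + j)"
        using X by (rule measure_extensions)
      finally have "real (card X) * (1/2) ^ t * (1/2) ^ j \<le> 2 * (1/2) ^ D * (1/2) ^ j"
        by (simp only: power_add mult.assoc mult_1)
      then have "real (card X) * (1/2) ^ t \<le> 2 * (1/2) ^ D" by (rule mult_right_le_imp_le) simp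
      with \<epsilon> D show False by linarith
    qed
    then obtain x where x: "x \<in> X" "measure cantor_measure (G \<inter> cyl (x @ replicate j False)) \<noteq> 0" by blast
    let ?x = "x @ replicate j False"
    have "prefix \<sigma> ?x" using x(1) by (auto simp: X_def intro: prefix_prefix)
    moreover have "length \<sigma> < length ?x" using t X(2)[OF x(1)] by simp
    moreover have "?x \<in> block_test Q d"
    proof -
      have "d < D" by (simp add: D_def)
      moreover have "\<forall>i<j. \<not> (t + i < length ?x \<and> ?x ! (t + i))"
        using X(2)[OF x(1)] by (auto simp: nth_append)
      moreover have "length ?x = t + j" using X(2)[OF x(1)] by simp
      ultimately show ?thesis unfolding block_test_def using tj(1) by blast
    qed
    moreover have "0 < measure cantor_measure (G \<inter> cyl ?x)" using x(2) by (simp add: zero_less_measure_iff)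
    ultimately show ?thesis by blast
  qed

  have base: "0 < measure cantor_measure (G \<inter> cyl [])"
  proof -
    have "measure cantor_measure (\<Union>n. B (0 + n)) \<le> (1/2) ^ c * suminf (\<lambda>n. (1/2) ^ f n)"
      by (rule tail_le) (use sum_le_suminf[OF sm] in simp)
    also have "\<dots> < 1" using c suminf_nonneg[OF sm] by (simp add: power_one_over field_simps)
    finally have "measure cantor_measure (\<Union>n. B n) < 1" by simp
    moreover have "measure cantor_measure G = 1 - measure cantor_measure (\<Union>n. B n)"
      unfolding G_def by (rule cantor.prob_compl) (use B_sets in auto)
    moreover have "G \<inter> cyl [] = G" by (auto simp: cyl_def initial_def)
    ultimately show ?thesis by simp
  qed
  have "\<exists>\<sigma>. \<forall>d. 0 < measure cantor_measure (G \<inter> cyl (\<sigma> d)) \<and> (prefix (\<sigma> d) (\<sigma> (Suc d)) \<and>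
      length (\<sigma> d) < length (\<sigma> (Suc d)) \<and> \<sigma> (Suc d) \<in> block_test Q d)"
    by (rule dependent_nat_choice) (use base extend in blast)+
  then obtain \<sigma> where \<sigma>: "\<And>d. 0 < measure cantor_measure (G \<inter> cyl (\<sigma> d))"
    "\<And>d. prefix (\<sigma> d) (\<sigma> (Suc d))" "\<And>d. length (\<sigma> d) < length (\<sigma> (Suc d))"
    "\<And>d. \<sigma> (Suc d) \<in> block_test Q d"
    by blast
  have \<sigma>_prefix: "prefix (\<sigma> d) (\<sigma> e)" if "d \<le> e" for d e
    using that by (induction rule: dec_induct) (auto intro: prefix_order.trans \<sigma>(2))
  have \<sigma>_length: "d \<le> length (\<sigma> d)" for d
    by (induction d) (use \<sigma>(3) in \<open>auto intro: Suc_leI le_less_trans\<close>)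
  define A where "A i = \<sigma> (Suc i) ! i" for i
  have A: "A \<in> cyl (\<sigma> d)" for d
    unfolding in_cyl_iff
  proof (intro allI impI)
    fix i assume i: "i < length (\<sigma> d)"
    have i': "i < length (\<sigma> (Suc i))" using \<sigma>_length[of "Suc i"] by simp
    consider "d \<le> Suc i" | "Suc i \<le> d" by linarith
    then show "A i = \<sigma> d ! i"
      unfolding A_def using i i' \<sigma>_prefix[of d "Suc i"] \<sigma>_prefix[of "Suc i" d]
      by cases (auto simp: prefix_def nth_append)
  qed
  have "\<not> bad (initial A n)" for n
  proof
    assume bad: "bad (initial A n)"
    \<comment> \<open>\<open>\<sigma> n\<close> has length at least \<open>n\<close>, so a bad
      prefix of \<open>A\<close> of length \<open>n\<close> would be shared by its whole cylinder,
      which nevertheless meets \<open>G\<close>.\<close>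
    have "initial A' n = initial A n" if "A' \<in> cyl (\<sigma> n)" for A'
      using that A[of n] \<sigma>_length[of n] unfolding in_cyl_iff initial_eq_iff by auto
    then have "G \<inter> cyl (\<sigma> n) = {}" using bad by (auto simp: G_iff) metis
    then show False using \<sigma>(1)[of n] by simp
  qed
  then have "\<forall>n. int n - int (f n) - int c \<le> int (complexity U (initial A n))"
    by (simp add: bad_def not_less)
  moreover have "A \<in> (\<Inter>d. cylinders (block_test Q d))"
    using A \<sigma>(4) unfolding cylinders_eq by blast
  then have "\<not> ml_random A"
    using block_test_ml_test[OF Q cost] unfolding ml_random_def by blast
  ultimately show ?thesis by blast
qed

theorem mainTheorem5:
  fixes U V :: machine and f :: "nat \<Rightarrow> nat"
  assumes "optimal_plain U" and "optimal_prefix_free V"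
    and "right_ce f"
    and "\<And>A :: nat \<Rightarrow> bool.
      (\<exists>c::int. \<forall>n. int (complexity U (initial A n)) \<ge> int n - int (f n) - c) \<longleftrightarrow> ml_random A"
  shows "weak_solovay_function V f \<and> (computable f \<longrightarrow> solovay_function V f)"
proof -
  \<comment> \<open>This uses the hypothesis from randomness to the bound, together with the
    existence of a random sequence.\<close>
  have sm: "summable (\<lambda>n. (1/2 :: real) ^ f n)"
  proof (rule ccontr)
    assume "\<not> ?thesis"
    then have "\<not> ml_random A" for A
      using low_complexity_if_divergent[OF assms(1,3), of A] assms(4)[of A] by (meson not_less)
    then show False using ml_random_exists by blast
  qed
  \<comment> \<open>This uses the converse direction, from the bound to randomness.\<close>
  have "\<exists>c. infinite {n. f n \<le> complexity_nat V n + c}"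
  proof (rule ccontr)
    assume "\<not> ?thesis"
    then have "\<And>c. finite {n. f n \<le> complexity_nat V n + c}" by blast
    from complex_nonrandom_sequence[OF assms(1-3) sm this] assms(4) show False by blast
  qed
  with complexity_le_if_summable[OF assms(2,3) sm] have "solovay_bounds V f"
    by (simp add: solovay_bounds_def)
  with assms(3) show ?thesis
    by (simp add: weak_solovay_function_def solovay_function_def)
qed

end
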